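(* Let $q$ be any prime power, $\mathcal{S}=\mathcal{Q}(5,q)$ and $\mathcal{S}'=\mathcal{Q}(4,q)$ a subquadrangle of $\mathcal{S}$. Let $\mathcal{A}$ be the affine quadrangle $\mathcal{S}\setminus\mathcal{S}'$, $\mathcal{E}$ the geometry of subtended ovoids and rosettes of $\mathcal{S}'$, and $\pi:\mathcal{A}\mapsto\mathcal{E}$ the natural projection. Then every cover $\gamma:\mathcal{A}\mapsto\mathcal{E}$ (in particular every $2$-cover) factorizes as $\gamma=\pi\circ\widetilde{\alpha}$, where $\widetilde{\alpha}$ is (the restriction to $\mathcal{A}$ of) an automorphism of $\mathcal{S}$ stabilizing $\mathcal{S}'$.
   Context: $\mathcal{Q}(5,q)$ is the generalized quadrangle of order $(q,q^2)$ of points and lines of a nonsingular elliptic quadric in $\mathbf{PG}(5,q)$; $\mathcal{Q}(4,q)$ is the generalized quadrangle of order $(q,q)$ of points and lines of a nonsingular parabolic quadric in $\mathbf{PG}(4,q)$, here embedded in $\mathcal{Q}(5,q)$ as the intersection with a nontangent hyperplane. For a point $x$, $x^\perp$ is the set of points collinear with $x$ (including $x$). The geometry $\mathcal{A}$ consists of the points and lines of $\mathcal{S}$ not in $\mathcal{S}'$, with the induced incidence. For a point $x$ of $\mathcal{S}\setminus\mathcal{S}'$, $\mathcal{O}_x:=x^\perp\cap\mathcal{S}'$ is an ovoid of $\mathcal{S}'$ (a point set meeting each line in exactly one point), called the ovoid subtended by $x$. For a line $L$ of $\mathcal{S}$ not in $\mathcal{S}'$, meeting $\mathcal{S}'$ in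 the point $\ell$, the rosette $R_L$ is the set of all $\mathcal{O}_x$ with $x$ on $L$, $x\ne\ell$. The geometry $\mathcal{E}$ has as points the subtended ovoids of $\mathcal{S}'$, as lines the rosettes $R_L$, and incidence is containment. The natural projection $\pi$ sends each point $x$ to $\mathcal{O}_x$ and each line $L$ to $R_L$. A morphism of point-line geometries maps points to points, lines to lines, and preserves incidence. A cover $\gamma:\Gamma\mapsto\Gamma'$ (with $\Gamma$ nonempty) is a morphism which is locally bijective: for each point $x$ of $\Gamma$ it induces a bijection between the lines on $x$ and the lines on $\gamma(x)$, and for each line $L$ of $\Gamma$ a bijection between the points on $L$ and the points on $\gamma(L)$. It is a $\theta$-cover if all fibers (of points and of lines) have constant size $\theta$. *)

theory Defs
  imports "HOL-Analysis.Cartesian_Space"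
begin

record ('p, 'l) geometry =
  points :: "'p set"
  lines :: "'l set"
  inc :: "'p \<Rightarrow> 'l \<Rightarrow> bool"

text \<open>A morphism consists of a map on points and a map on lines; their values outside the
  points and lines of the source geometry are irrelevant.\<close>

definition morphism ::
  "('p, 'l) geometry \<Rightarrow> ('r, 'm) geometry \<Rightarrow> ('p \<Rightarrow> 'r) \<Rightarrow> ('l \<Rightarrow> 'm) \<Rightarrow> bool" where
  "morphism G G' f g \<longleftrightarrow>
     f ` points G \<subseteq> points G' \<and> g ` lines G \<subseteq> lines G' \<and>
     (\<forall>x\<in>points G. \<forall>L\<in>lines G. inc G x L \<longrightarrow> inc G' (f x) (g L))"

definition lines_on :: "('p, 'l) geometry \<Rightarrow> 'p \<Rightarrow> 'l set" where
  "lines_on G x = {L \<in> lines G. inc G x L}"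

definition points_on :: "('p, 'l) geometry \<Rightarrow> 'l \<Rightarrow> 'p set" where
  "points_on G L = {x \<in> points G. inc G x L}"

definition cover ::
  "('p, 'l) geometry \<Rightarrow> ('r, 'm) geometry \<Rightarrow> ('p \<Rightarrow> 'r) \<Rightarrow> ('l \<Rightarrow> 'm) \<Rightarrow> bool" where
  "cover G G' f g \<longleftrightarrow>
     points G \<noteq> {} \<and> morphism G G' f g \<and>
     (\<forall>x\<in>points G. bij_betw g (lines_on G x) (lines_on G' (f x))) \<and>
     (\<forall>L\<in>lines G. bij_betw f (points_on G L) (points_on G' (g L)))"

definition automorphism :: "('p, 'l) geometry \<Rightarrow> ('p \<Rightarrow> 'p) \<Rightarrow> ('l \<Rightarrow> 'l) \<Rightarrow> bool" where
  "automorphism G f g \<longleftrightarrow>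
     bij_betw f (points G) (points G) \<and> bij_betw g (lines G) (lines G) \<and>
     (\<forall>x\<in>points G. \<forall>L\<in>lines G. inc G (f x) (g L) \<longleftrightarrow> inc G x L)"

definition stabilizes :: "('p \<Rightarrow> 'p) \<Rightarrow> ('l \<Rightarrow> 'l) \<Rightarrow> ('p, 'l) geometry \<Rightarrow> bool" where
  "stabilizes f g G \<longleftrightarrow> f ` points G = points G \<and> g ` lines G = lines G"

definition perp :: "('p, 'l) geometry \<Rightarrow> 'p \<Rightarrow> 'p set" where
  "perp G x = {y \<in> points G. y = x \<or> (\<exists>L\<in>lines G. inc G x L \<and> inc G y L)}"

definition complement_geometry ::
  "('p, 'l) geometry \<Rightarrow> ('p, 'l) geometry \<Rightarrow> ('p, 'l) geometry" where
  "complement_geometry S S' =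
     \<lparr>points = points S - points S', lines = lines S - lines S', inc = inc S\<rparr>"

definition subtended_ovoid ::
  "('p, 'l) geometry \<Rightarrow> ('p, 'l) geometry \<Rightarrow> 'p \<Rightarrow> 'p set" where
  "subtended_ovoid S S' x = perp S x \<inter> points S'"

text \<open>For a line \<open>L\<close> outside \<open>S'\<close>, the points of the complement on \<open>L\<close> are the points of
  \<open>L\<close> other than its unique point in \<open>S'\<close>.\<close>

definition rosette ::
  "('p, 'l) geometry \<Rightarrow> ('p, 'l) geometry \<Rightarrow> 'l \<Rightarrow> 'p set set" where
  "rosette S S' L = subtended_ovoid S S' ` points_on (complement_geometry S S') L"

definition ovoid_geometry ::
  "('p, 'l) geometry \<Rightarrow> ('p, 'l) geometry \<Rightarrow> ('p set, 'p set set) geometry" where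
  "ovoid_geometry S S' =
     \<lparr>points = subtended_ovoid S S' ` points (complement_geometry S S'),
      lines = rosette S S' ` lines (complement_geometry S S'),
      inc = (\<in>)\<rparr>"

text \<open>The projective space is that of the vector space \<open>'a ^ 'n\<close>: its points, lines and
  hyperplanes are the linear subspaces of dimension \<open>1\<close>, \<open>2\<close> and \<open>CARD('n) - 1\<close>.\<close>

definition quadratic_form :: "('a::field ^ 'n \<Rightarrow> 'a) \<Rightarrow> bool" where
  "quadratic_form Q \<longleftrightarrow>
     (\<exists>A :: 'a ^ 'n ^ 'n. \<forall>v. Q v = (\<Sum>i\<in>UNIV. \<Sum>j\<in>UNIV. A $ i $ j * v $ i * v $ j))"

definition polar_form :: "('a::field ^ 'n \<Rightarrow> 'a) \<Rightarrow> 'a ^ 'n \<Rightarrow> 'a ^ 'n \<Rightarrow> 'a" where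
  "polar_form Q u v = Q (u + v) - Q u - Q v"

text \<open>No point of the quadric is singular. Only singular vectors of the radical of the polar
  form are excluded, so the definition is also correct in characteristic two.\<close>

definition nonsingular_form :: "('a::field ^ 'n \<Rightarrow> 'a) \<Rightarrow> bool" where
  "nonsingular_form Q \<longleftrightarrow> (\<forall>v. Q v = 0 \<and> (\<forall>u. polar_form Q u v = 0) \<longrightarrow> v = 0)"

definition totally_singular :: "('a::field ^ 'n \<Rightarrow> 'a) \<Rightarrow> ('a ^ 'n) set \<Rightarrow> bool" where
  "totally_singular Q U \<longleftrightarrow> vec.subspace U \<and> (\<forall>v\<in>U. Q v = 0)"

definition witt_index :: "('a::field ^ 'n \<Rightarrow> 'a) \<Rightarrow> nat" where
  "witt_index Q = Max {vec.dim U | U. totally_singular Q U}"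

text \<open>A nonsingular quadric in odd projective dimension \<open>2m - 1\<close> is elliptic if its Witt index
  is \<open>m - 1\<close> (it is hyperbolic if the Witt index is \<open>m\<close>).\<close>

definition nonsingular_elliptic :: "('a::field ^ 'n \<Rightarrow> 'a) \<Rightarrow> bool" where
  "nonsingular_elliptic Q \<longleftrightarrow>
     quadratic_form Q \<and> nonsingular_form Q \<and> CARD('n) = 2 * (witt_index Q + 1)"

definition hyperplane :: "('a::field ^ 'n) set \<Rightarrow> bool" where
  "hyperplane H \<longleftrightarrow> vec.subspace H \<and> vec.dim H + 1 = CARD('n)"

definition tangent_hyperplane :: "('a::field ^ 'n \<Rightarrow> 'a) \<Rightarrow> ('a ^ 'n) set \<Rightarrow> bool" where
  "tangent_hyperplane Q H \<longleftrightarrow>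
     hyperplane H \<and> (\<exists>p. p \<noteq> 0 \<and> Q p = 0 \<and> H = {v. polar_form Q p v = 0})"

definition quadric_section ::
  "('a::field ^ 'n \<Rightarrow> 'a) \<Rightarrow> ('a ^ 'n) set \<Rightarrow> (('a ^ 'n) set, ('a ^ 'n) set) geometry" where
  "quadric_section Q H =
     \<lparr>points = {P. totally_singular Q P \<and> vec.dim P = 1 \<and> P \<subseteq> H},
      lines = {L. totally_singular Q L \<and> vec.dim L = 2 \<and> L \<subseteq> H},
      inc = (\<subseteq>)\<rparr>"

definition quadric_geometry ::
  "('a::field ^ 'n \<Rightarrow> 'a) \<Rightarrow> (('a ^ 'n) set, ('a ^ 'n) set) geometry" where
  "quadric_geometry Q = quadric_section Q UNIV"

end

(* After normalization by the polar form with the centre p of the hyperplane H = p^perp, the points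
   of A are the singular vectors x with B p x = Q p, two of them are collinear iff B x y = 0, and the
   deck transformation of pi is the reflection x |-> p - x. Counting shows that every cover
   A -> E has fibres of size two, so both pi and gamma give classes in H^1(E, Z/2). A proper triangle
   of E cannot lift to a closed path, since A has no proper triangles, and triangles inside a line of E
   always do; hence the two classes agree on all triangles. The collinearity graph of E has diameter two
   and its cycles decompose into triangles: quadrangles, because the common neighbours of two points
   are linked by triangles (an expansion count on the points of an elliptic quadric in PG(3,q) off a
   plane), and pentagons, because they can be cut into triangles and quadrangles. So the classes
   coincide and gamma = pi o alpha with alpha an automorphism of A. Finally alpha extends to S, since
   the points of S' are the parallel classes of lines of A. *)

theory Submission
  imports Defs
begin

section \<open>Quadratic forms and orthogonality\<close>

text \<open>The size two of the fibres drives the comparison of classes: a path lifted to a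
  two-sheeted cover either closes or ends on the other sheet, so knowing that a triangle does not
  lift to a closed path determines the value of the class on it. Hence the fibre count comes before
  the comparison. The main obstacle is the connectivity of the common neighbours of two points at
  distance two. No group action is used: every vertex has at least q + 1 neighbours among at most
  q^2 + 1 vertices, and two vertices usually share at most two of them, so more than half of all
  vertices are reached in two steps. After normalization each point of A is a single vector, a point
  of E is a pair of twins x and p - x, and two points of E are adjacent when the polar form takes
  the value 0 or Q p. Cochains are evaluated on vectors, and twins are separate arguments, adjacent
  to each other. No step divides by 2, so even and odd characteristic are treated together, apart
  from the nondegeneracy of the polar form.\<close>

locale quadratic_space =
  fixes Q :: "'a::{field,finite} ^ 'n \<Rightarrow> 'a"
  assumes quadratic: "quadratic_form Q"
begin

abbreviation B :: "'a ^ 'n \<Rightarrow> 'a ^ 'n \<Rightarrow> 'a" where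
  "B \<equiv> polar_form Q"

lemma gram_matrix: "\<exists>M :: 'a ^ 'n ^ 'n. \<forall>v. Q v = (\<Sum>i\<in>UNIV. \<Sum>j\<in>UNIV. M $ i $ j * v $ i * v $ j)"
  using quadratic unfolding quadratic_form_def .

lemma Q_scale [simp]: "Q (c *s v) = c\<^sup>2 * Q v"
proof -
  from gram_matrix obtain M :: "'a ^ 'n ^ 'n"
    where M: "\<forall>v. Q v = (\<Sum>i\<in>UNIV. \<Sum>j\<in>UNIV. M $ i $ j * v $ i * v $ j)" ..
  show ?thesis unfolding M[rule_format] sum_distrib_left
    by (intro sum.cong refl) (simp add: algebra_simps power2_eq_square)
qed

lemma Q_add: "Q (u + v) = Q u + Q v + B u v"
  by (simp add: polar_form_def)

lemma B_sym: "B u v = B v u"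
  by (simp add: polar_form_def add.commute)

lemma B_expansion:
  "\<exists>M :: 'a ^ 'n ^ 'n. \<forall>u v. B u v = (\<Sum>i\<in>UNIV. \<Sum>j\<in>UNIV. M $ i $ j * (u $ i * v $ j + v $ i * u $ j))"
proof -
  from gram_matrix obtain M :: "'a ^ 'n ^ 'n"
    where M: "\<forall>v. Q v = (\<Sum>i\<in>UNIV. \<Sum>j\<in>UNIV. M $ i $ j * v $ i * v $ j)" ..
  have "B u v = (\<Sum>i\<in>UNIV. \<Sum>j\<in>UNIV. M $ i $ j * (u $ i * v $ j + v $ i * u $ j))" for u v
    unfolding polar_form_def M[rule_format] sum_subtractf[symmetric]
    by (intro sum.cong refl) (simp add: algebra_simps)
  thus ?thesis by (intro exI allI)
qed

lemma B_add_left [simp]: "B (u + v) w = B u w + B v w"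
proof -
  from B_expansion obtain M :: "'a ^ 'n ^ 'n"
    where M: "\<forall>u v. B u v = (\<Sum>i\<in>UNIV. \<Sum>j\<in>UNIV. M $ i $ j * (u $ i * v $ j + v $ i * u $ j))" ..
  show ?thesis unfolding M[rule_format] sum.distrib[symmetric]
    by (intro sum.cong refl) (simp add: algebra_simps)
qed

lemma B_scale_left [simp]: "B (c *s u) w = c * B u w"
proof -
  from B_expansion obtain M :: "'a ^ 'n ^ 'n"
    where M: "\<forall>u v. B u v = (\<Sum>i\<in>UNIV. \<Sum>j\<in>UNIV. M $ i $ j * (u $ i * v $ j + v $ i * u $ j))" ..
  show ?thesis unfolding M[rule_format] sum_distrib_left
    by (intro sum.cong refl) (simp add: algebra_simps)
qed

lemma B_add_right [simp]: "B w (u + v) = B w u + B w v"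
  by (metis B_add_left B_sym)

lemma B_scale_right [simp]: "B w (c *s u) = c * B w u"
  by (metis B_scale_left B_sym)

lemma B_zero [simp]: "B 0 w = 0" "B w 0 = 0"
  using B_scale_left[of 0 0] B_scale_right[of _ 0 0] by auto

lemma Q_zero [simp]: "Q 0 = 0"
  using Q_scale[of 0 0] by simp

lemma B_minus [simp]: "B (- u) w = - B u w" "B w (- u) = - B w u"
  using B_scale_left[of "-1"] B_scale_right[of _ "-1"]
  by (simp_all add: vector_sneg_minus1[symmetric])

lemma B_diff [simp]: "B (u - v) w = B u w - B v w" "B w (u - v) = B w u - B w v"
  by (simp_all only: diff_conv_add_uminus B_add_left B_add_right B_minus)

lemma Q_minus [simp]: "Q (- u) = Q u"
  using Q_scale[of "-1" u] by (simp add: vector_sneg_minus1[symmetric])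

lemma Q_diff: "Q (u - v) = Q u + Q v - B u v"
  using Q_add[of u "- v"] by simp

lemma B_self: "B v v = 2 * Q v"
proof -
  have "v + v = 2 *s v" by (vector)
  hence "Q (v + v) = 4 * Q v" by simp
  thus ?thesis by (simp add: polar_form_def)
qed

lemma linear_B: "Vector_Spaces.linear (*s) (*) (B x)"
  by unfold_locales (simp_all add: algebra_simps)

definition perp_space :: "('a ^ 'n) set \<Rightarrow> ('a ^ 'n) set" where
  "perp_space X = {y. \<forall>x\<in>X. B x y = 0}"

lemma subspace_perp: "vec.subspace (perp_space X)"
  unfolding perp_space_def vec.subspace_def by auto

lemma perp_space_insert: "perp_space (insert x X) = {y \<in> perp_space X. B x y = 0}"
  by (auto simp: perp_space_def)

lemma subspace_perp_vec: "vec.subspace {y. B x y = 0}"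
  unfolding vec.subspace_def by auto

lemma span_perp:
  assumes "\<And>x. x \<in> X \<Longrightarrow> B x y = 0" and "v \<in> vec.span X"
  shows "B v y = 0"
proof -
  have "vec.span X \<subseteq> {x. B y x = 0}"
  proof (rule vec.span_minimal)
    show "X \<subseteq> {x. B y x = 0}" using assms(1) by (auto simp: B_sym[of y])
  qed (rule subspace_perp_vec)
  thus ?thesis using assms(2) B_sym by auto
qed

lemma dim_kernel:
  assumes "vec.subspace T"
  shows "vec.dim T \<le> vec.dim {y \<in> T. B x y = 0} + 1"
    and "y0 \<in> T \<Longrightarrow> B x y0 \<noteq> 0 \<Longrightarrow> vec.dim T = vec.dim {y \<in> T. B x y = 0} + 1"
proof -
  let ?K = "{y \<in> T. B x y = 0}"
  have K: "vec.subspace ?K"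
    using assms unfolding vec.subspace_def by auto
  have eq: "vec.dim T = vec.dim ?K + 1" if y0: "y0 \<in> T" "B x y0 \<noteq> 0" for y0
  proof -
    have "y0 \<notin> vec.span ?K"
      using K y0 by (simp add: vec.span_eq_iff[THEN iffD2])
    hence d: "vec.dim (insert y0 ?K) = vec.dim ?K + 1"
      by (simp add: vec.dim_insert)
    have "T \<subseteq> vec.span (insert y0 ?K)"
    proof
      fix y assume y: "y \<in> T"
      let ?t = "B x y / B x y0"
      have "y - ?t *s y0 \<in> ?K"
        using y y0 assms by (auto intro: vec.subspace_diff vec.subspace_scale)
      hence "(y - ?t *s y0) + ?t *s y0 \<in> vec.span (insert y0 ?K)"
        by (intro vec.span_add vec.span_scale) (auto intro: vec.span_base)
      thus "y \<in> vec.span (insert y0 ?K)" by simp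
    qed
    hence "vec.dim T \<le> vec.dim (insert y0 ?K)"
      by (metis vec.dim_mono)
    moreover have "vec.dim (insert y0 ?K) \<le> vec.dim T"
      by (rule vec.dim_subset) (use y0 in auto)
    ultimately show ?thesis using d by simp
  qed
  show "vec.dim T \<le> vec.dim ?K + 1"
  proof (cases "\<exists>y0\<in>T. B x y0 \<noteq> 0")
    case True
    thus ?thesis using eq by fastforce
  next
    case False
    hence "?K = T" by auto
    thus ?thesis by simp
  qed
  show "y0 \<in> T \<Longrightarrow> B x y0 \<noteq> 0 \<Longrightarrow> vec.dim T = vec.dim ?K + 1" by (rule eq)
qed

end

lemma in_span_insertE:
  fixes x :: "'a::field ^ 'n"
  assumes "x \<in> vec.span (insert a X)"
  obtains t y where "y \<in> vec.span X" "x = t *s a + y"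
  using assms by (metis vec.span_breakdown_eq add.commute diff_add_cancel)

lemma in_span1E:
  fixes x :: "'a::field ^ 'n"
  assumes "x \<in> vec.span {a}"
  obtains t where "x = t *s a"
  using assms by (auto simp: vec.span_singleton)

lemma in_span2E:
  fixes x :: "'a::field ^ 'n"
  assumes "x \<in> vec.span {a, b}"
  obtains t u where "x = t *s a + u *s b"
  using assms by (elim in_span_insertE in_span1E) (simp add: vec.span_singleton)

lemma in_span2I: "t *s a + u *s b \<in> vec.span {a, b :: 'a::field ^ 'n}"
  by (intro vec.span_add vec.span_scale) (auto intro: vec.span_base)

lemma dim_span2:
  fixes a b :: "'a::field ^ 'n"
  assumes "a \<noteq> 0" "b \<notin> vec.span {a}"
  shows "vec.dim (vec.span {a, b}) = 2"
  using assms vec.dim_insert[of b "{a}"] by (simp add: insert_commute)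

lemma dim_span3:
  fixes a b c :: "'a::field ^ 'n"
  assumes "a \<noteq> 0" "b \<notin> vec.span {a}" "c \<notin> vec.span {a, b}"
  shows "vec.dim (vec.span {a, b, c}) = 3"
  using assms vec.dim_insert[of b "{a}"] vec.dim_insert[of c "{a, b}"]
  by (simp add: insert_commute)

text \<open>In characteristic two \<open>x\<close> and \<open>- x\<close> coincide, so squaring is
  injective, hence bijective on a finite field.\<close>

lemma square_surjective_char2:
  fixes c :: "'a::{field,finite}"
  assumes "(2::'a) = 0"
  shows "\<exists>l. l\<^sup>2 = c"
proof -
  have "inj (\<lambda>l::'a. l\<^sup>2)"
  proof (rule injI)
    fix x y :: 'a assume "x\<^sup>2 = y\<^sup>2"
    hence "x = y \<or> x = - y" by (simp add: power2_eq_iff)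
    moreover have "- y = y" using assms
      by (metis add_eq_0_iff mult_2 mult_zero_left)
    ultimately show "x = y" by auto
  qed
  hence "surj (\<lambda>l::'a. l\<^sup>2)" by (simp add: finite_UNIV_inj_surj)
  thus ?thesis by (metis surjD)
qed

section \<open>Nonsingular quadrics of Witt index two in projective five-space\<close>

locale elliptic_space = quadratic_space Q
  for Q :: "'a::{field,finite} ^ 6 \<Rightarrow> 'a" +
  assumes nonsingular: "nonsingular_form Q" and witt: "witt_index Q = 2"
begin

lemma totally_singular_dims_finite: "finite {vec.dim U | U. totally_singular Q U}"
proof (rule finite_subset)
  have "vec.dim U \<le> 6" for U :: "('a ^ 6) set"
    using dim_subset_UNIV_cart_gen[of U] by simp
  thus "{vec.dim U | U. totally_singular Q U} \<subseteq> {..6}" by auto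
qed simp

lemma totally_singular_dim_le: "totally_singular Q U \<Longrightarrow> vec.dim U \<le> 2"
  using Max_ge[OF totally_singular_dims_finite, of "vec.dim U"] witt
  unfolding witt_index_def by auto

lemma totally_singular_line_exists: "\<exists>U. totally_singular Q U \<and> vec.dim U = 2"
proof -
  have "totally_singular Q {0}" by (simp add: totally_singular_def)
  hence "{vec.dim U | U. totally_singular Q U} \<noteq> {}" by blast
  from Max_in[OF totally_singular_dims_finite this] show ?thesis
    using witt unfolding witt_index_def by auto
qed

lemma totally_singular_span:
  assumes "\<And>x. x \<in> X \<Longrightarrow> Q x = 0" "\<And>x y. x \<in> X \<Longrightarrow> y \<in> X \<Longrightarrow> B x y = 0"
  shows "totally_singular Q (vec.span X)"
proof -
  have 1: "B v x = 0" if "x \<in> X" "v \<in> vec.span X" for v x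
    using that assms(2) by (intro span_perp[of X x v]) auto
  have 2: "B x y = 0" if "x \<in> vec.span X" "y \<in> vec.span X" for x y
    by (rule span_perp[OF _ that(1)]) (use 1 that(2) B_sym in metis)
  have "vec.span X \<subseteq> {v \<in> vec.span X. Q v = 0}"
  proof (rule vec.span_minimal)
    show "vec.subspace {v \<in> vec.span X. Q v = 0}"
      using 2 unfolding vec.subspace_def
      by (auto simp: Q_add intro: vec.span_add vec.span_scale vec.span_zero)
  qed (use assms(1) vec.span_base in auto)
  hence "Q x = 0" if "x \<in> vec.span X" for x using that by blast
  thus ?thesis by (simp add: totally_singular_def)
qed

text \<open>A third independent vector would give a totally singular subspace of dimension three,
  above the Witt index. This is the source of every later use of the absence of triangles in the
  quadrangle.\<close>

lemma no_triangle:
  assumes "Q a = 0" "Q b = 0" "Q e = 0" "B a b = 0" "B a e = 0" "B b e = 0"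
    and "a \<noteq> 0" "b \<notin> vec.span {a}"
  shows "e \<in> vec.span {a, b}"
proof (rule ccontr)
  assume "e \<notin> vec.span {a, b}"
  hence "vec.dim (vec.span {a, b, e}) = 3" using assms by (intro dim_span3)
  moreover have "totally_singular Q (vec.span {a, b, e})"
    by (rule totally_singular_span) (use assms B_sym B_self in auto)
  ultimately show False using totally_singular_dim_le by fastforce
qed

lemma totally_singular_B:
  assumes "totally_singular Q U" "x \<in> U" "y \<in> U"
  shows "B x y = 0"
  using assms by (simp add: totally_singular_def polar_form_def vec.subspace_add)

text \<open>In odd characteristic this is immediate. In characteristic two, if \<open>r\<close> spanned the radical,
  then for a totally singular line \<open>L\<close> the space \<open>L\<^sup>\<bottom> / L\<close> would contain a vector other than
  the multiples of \<open>r\<close>, and a multiple of \<open>r\<close> corrects it to a singular one.\<close>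

lemma nondegenerate:
  assumes "\<And>u. B u r = 0"
  shows "r = 0"
proof (rule ccontr)
  assume r: "r \<noteq> 0"
  hence Qr: "Q r \<noteq> 0"
    using nonsingular[unfolded nonsingular_form_def, rule_format, of r] assms by auto
  have two: "(2::'a) = 0" using B_self[of r] assms[of r] Qr by simp
  obtain U where U: "totally_singular Q U" "vec.dim U = 2"
    using totally_singular_line_exists by blast
  obtain X where X: "X \<subseteq> U" "vec.independent X" "vec.span X = U" "card X = 2"
    using vec.basis_exists[of U] U by (metis totally_singular_def vec.span_subspace)
  obtain l m where lm: "X = {l, m}" "l \<noteq> m" using X(4) by (meson card_2_iff)
  have lmU: "l \<in> U" "m \<in> U" using lm X by auto
  have sub: "vec.subspace {y. B l y = 0}" by (rule subspace_perp_vec)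
  have "vec.dim (UNIV :: ('a ^ 6) set) = 6" by (subst vec_dim_card) simp
  moreover have "vec.dim (UNIV :: ('a ^ 6) set) \<le> vec.dim {y. B l y = 0} + 1"
    using dim_kernel(1)[of UNIV l] by simp
  moreover have "vec.dim {y. B l y = 0} \<le> vec.dim {y. B l y = 0 \<and> B m y = 0} + 1"
    using dim_kernel(1)[OF sub, of m] by simp
  ultimately have 4: "vec.dim {y. B l y = 0 \<and> B m y = 0} \<ge> 4" by simp
  have "\<not> {y. B l y = 0 \<and> B m y = 0} \<subseteq> vec.span {l, m, r}"
  proof
    assume "{y. B l y = 0 \<and> B m y = 0} \<subseteq> vec.span {l, m, r}"
    hence "vec.dim {y. B l y = 0 \<and> B m y = 0} \<le> card {l, m, r}" by (intro vec.dim_le_card) auto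
    also have "\<dots> \<le> 3" by (simp add: card_insert_if)
    finally show False using 4 by simp
  qed
  then obtain y where y: "B l y = 0" "B m y = 0" "y \<notin> vec.span {l, m, r}" by auto
  obtain t where t: "t\<^sup>2 = Q y / Q r" using square_surjective_char2[OF two] by metis
  let ?e = "y - t *s r"
  have "Q ?e = Q y + t\<^sup>2 * Q r" using assms[of y] by (simp add: Q_diff)
  also have "\<dots> = 2 * Q y" using t Qr by simp
  finally have Qe: "Q ?e = 0" using two by simp
  have e: "B l ?e = 0" "B m ?e = 0" using y assms by auto
  have "l \<noteq> 0" "m \<notin> vec.span {l}"
    using X(2) lm vec.dependent_zero vec.independent_insert[of m "{l}"]
    by (auto simp: insert_commute)
  moreover have "Q l = 0" "Q m = 0" "B l m = 0"
    using U lmU totally_singular_B by (auto simp: totally_singular_def)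
  ultimately have "?e \<in> vec.span {l, m}" using no_triangle Qe e by metis
  hence "?e \<in> vec.span {l, m, r}" by (meson insert_mono subset_insertI vec.span_mono in_mono empty_subsetI)
  hence "?e + t *s r \<in> vec.span {l, m, r}"
    by (intro vec.span_add vec.span_scale) (auto intro: vec.span_base)
  thus False using y by simp
qed

text \<open>By nondegeneracy a vector is determined by its products with the standard basis, so in
  finite dimension every prescribed list of products occurs.\<close>

lemma functional_representation:
  assumes "Vector_Spaces.linear (*s) (*) g"
  shows "\<exists>y. \<forall>x. B x y = g x"
proof -
  interpret g: Vector_Spaces.linear "(*s)" "(*)" g by fact
  let ?T = "\<lambda>y. \<chi> i. B (axis i 1) y"
  have lin: "Vector_Spaces.linear (*s) (*s) ?T"
    by unfold_locales (simp_all add: vec_eq_iff algebra_simps)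
  have expand: "x = (\<Sum>i\<in>UNIV. x $ i *s axis i 1)" for x :: "'a ^ 6"
    by (simp add: basis_expansion)
  have B_expand: "B x y = (\<Sum>i\<in>UNIV. x $ i * B (axis i 1) y)" for x y
  proof -
    interpret b: Vector_Spaces.linear "(*s)" "(*)" "B y" by (rule linear_B)
    have "B y x = B y (\<Sum>i\<in>UNIV. x $ i *s axis i 1)" using expand[of x] by simp
    also have "\<dots> = (\<Sum>i\<in>UNIV. x $ i * B y (axis i 1))" by (simp add: b.sum)
    finally show ?thesis by (simp add: B_sym)
  qed
  have "inj ?T"
  proof (rule injI)
    fix y z assume "?T y = ?T z"
    hence *: "B (axis i 1) (y - z) = 0" for i by (simp add: vec_eq_iff)
    have "B u (y - z) = 0" for u by (subst B_expand) (simp only: *, simp)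
    from nondegenerate[OF this] show "y = z" by simp
  qed
  hence "surj ?T" using vec.linear_injective_imp_surjective lin by blast
  then obtain y where y: "?T y = (\<chi> i. g (axis i 1))" by (metis surjD)
  have "B x y = g x" for x
  proof -
    have "g x = g (\<Sum>i\<in>UNIV. x $ i *s axis i 1)" using expand[of x] by simp
    also have "\<dots> = (\<Sum>i\<in>UNIV. x $ i * g (axis i 1))" by (simp add: g.sum g.scale)
    finally show ?thesis using y by (simp add: B_expand[of x] vec_eq_iff)
  qed
  thus ?thesis by blast
qed

text \<open>Some functional is 1 at \<open>x\<close> and 0 on a basis of the span of
  \<open>X\<close>, and it is represented by a vector. This turns independence into a drop in the
  dimension of perpendicular spaces.\<close>

lemma separation:
  assumes "x \<notin> vec.span X"
  obtains y where "y \<in> perp_space X" "B x y = 1"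
proof -
  obtain X' where X': "X' \<subseteq> X" "vec.independent X'" "X \<subseteq> vec.span X'"
    using vec.maximal_independent_subset by blast
  have "x \<notin> vec.span X'" using assms X'(1) vec.span_mono by blast
  hence ind: "vec.independent (insert x X')" using X' vec.independent_insertI by blast
  interpret vs: vector_space_pair "(*s) :: 'a \<Rightarrow> 'a ^ 6 \<Rightarrow> 'a ^ 6" "(*) :: 'a \<Rightarrow> 'a \<Rightarrow> 'a" ..
  obtain g where g: "Vector_Spaces.linear (*s) (*) g"
      "\<forall>v\<in>insert x X'. g v = (if v = x then 1 else 0)"
    using vs.linear_independent_extend[OF ind, of "\<lambda>v. if v = x then 1 else 0"] by blast
  obtain y where y: "\<forall>v. B v y = g v" using functional_representation[OF g(1)] ..
  have "x \<notin> X'" using \<open>x \<notin> vec.span X'\<close> vec.span_base by blast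
  hence "B v y = 0" if "v \<in> X'" for v using y g(2) that by auto
  hence "B v y = 0" if "v \<in> X" for v
    by (rule span_perp[of X']) (use X'(3) that in auto)
  hence "y \<in> perp_space X" by (simp add: perp_space_def)
  moreover have "B x y = 1" using y g(2) by simp
  ultimately show thesis by (rule that)
qed

lemma dim_perp_insert:
  assumes "x \<notin> vec.span X"
  shows "vec.dim (perp_space X) = vec.dim (perp_space (insert x X)) + 1"
proof -
  obtain y where "y \<in> perp_space X" "B x y = 1" using separation[OF assms] .
  thus ?thesis using dim_kernel(2)[OF subspace_perp] by (simp add: perp_space_insert)
qed

lemma dim_perp_empty: "vec.dim (perp_space {}) = 6"
  using vec_dim_card[where ?'n = 6 and ?'a = 'a] by (simp add: perp_space_def)

text \<open>If all singular vectors of \<open>perp_space X\<close> were orthogonal to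
  \<open>x\<close>, so would be every \<open>y\<close> there with \<open>B v1 y \<noteq> 0\<close>,
  since a multiple of \<open>v1\<close> moves \<open>y\<close> to a singular vector. Such
  \<open>y\<close> span \<open>perp_space X\<close>, which contradicts
  \<open>separation\<close>.\<close>

lemma singular_perp_exists:
  assumes v1: "v1 \<in> perp_space X" "Q v1 = 0" "v1 \<notin> vec.span X" and x: "x \<notin> vec.span X"
  obtains d where "d \<in> perp_space X" "Q d = 0" "B x d \<noteq> 0"
proof -
  have "\<exists>d. d \<in> perp_space X \<and> Q d = 0 \<and> B x d \<noteq> 0"
  proof (rule ccontr)
    assume "\<not> ?thesis"
    hence *: "B x d = 0" if "d \<in> perp_space X" "Q d = 0" for d
      using that by blast
    have zero: "B x y = 0" if y: "y \<in> perp_space X" "B v1 y \<noteq> 0" for y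
    proof -
      let ?d = "y - (Q y / B v1 y) *s v1"
      have "?d \<in> perp_space X"
        using y v1 subspace_perp by (intro vec.subspace_diff vec.subspace_scale) auto
      moreover have "Q ?d = 0" using y v1 B_sym[of y v1] by (simp add: Q_diff)
      ultimately have "B x ?d = 0" by (rule *)
      thus ?thesis using *[OF v1(1,2)] by simp
    qed
    obtain y0 where y0: "y0 \<in> perp_space X" "B v1 y0 = 1" using separation[OF v1(3)] .
    obtain y where y: "y \<in> perp_space X" "B x y = 1" using separation[OF x] .
    show False
    proof (cases "B v1 y = 0")
      case True
      have "y + y0 \<in> perp_space X" using y y0 subspace_perp by (intro vec.subspace_add) auto
      moreover have "B v1 (y + y0) \<noteq> 0" using True y0 by simp
      ultimately have "B x (y + y0) = 0" by (rule zero)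
      moreover have "B x y0 = 0" using y0 by (intro zero) auto
      ultimately show False using y by simp
    next
      case False
      thus False using zero y by simp
    qed
  qed
  thus thesis using that by blast
qed

text \<open>A totally singular line either contains \<open>x\<close> or has a point orthogonal to
  \<open>x\<close>, as one linear condition lowers its dimension by at most one.\<close>

lemma singular_neighbour:
  assumes "Q x = 0" "x \<noteq> 0"
  obtains y where "Q y = 0" "B x y = 0" "y \<notin> vec.span {x}"
proof -
  obtain U where U: "totally_singular Q U" "vec.dim U = 2"
    using totally_singular_line_exists by blast
  have sU: "vec.subspace U" and sing: "\<And>v. v \<in> U \<Longrightarrow> Q v = 0" using U by (auto simp: totally_singular_def)
  show thesis
  proof (cases "x \<in> U")
    case True
    have "\<not> U \<subseteq> vec.span {x}"
    proof
      assume "U \<subseteq> vec.span {x}"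
      from vec.dim_mono[OF this] assms U show False by simp
    qed
    then obtain y where "y \<in> U" "y \<notin> vec.span {x}" by blast
    thus ?thesis using that sing totally_singular_B[OF U(1) True] by blast
  next
    case False
    have "\<not> {y \<in> U. B x y = 0} \<subseteq> {0}"
      using dim_kernel(1)[OF sU, of x] U vec.dim_eq_0[of "{y \<in> U. B x y = 0}"] by linarith
    then obtain y where y: "y \<in> U" "B x y = 0" "y \<noteq> 0" by blast
    have "y \<notin> vec.span {x}"
    proof
      assume "y \<in> vec.span {x}"
      then obtain t where t: "y = t *s x" by (rule in_span1E)
      hence "x = (1/t) *s y" using y by auto
      thus False using False y sU vec.subspace_scale by metis
    qed
    thus ?thesis using that y sing by blast
  qed
qed

end

section \<open>Affine representatives and conics\<close>

lemma dim_1_span: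
  fixes T :: "('a::field ^ 'n) set"
  assumes "vec.subspace T" "vec.dim T = 1" "d \<in> T" "d \<noteq> 0"
  shows "T = vec.span {d}"
proof -
  have "vec.span {d} \<subseteq> T" using assms by (simp add: vec.span_minimal)
  moreover have "vec.dim (vec.span {d}) = 1" using assms by simp
  ultimately show ?thesis using assms vec.subspace_dim_equal[of "vec.span {d}" T] by simp
qed

lemma dim_2_span:
  fixes T :: "('a::field ^ 'n) set"
  assumes "vec.subspace T" "vec.dim T = 2" "a \<in> T" "b \<in> T" "a \<noteq> 0" "b \<notin> vec.span {a}"
  shows "T = vec.span {a, b}"
proof -
  have "vec.span {a, b} \<subseteq> T" using assms by (simp add: vec.span_minimal)
  thus ?thesis
    using assms vec.subspace_dim_equal[of "vec.span {a, b}" T] dim_span2[of a b] by simp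
qed

lemma dim_2_extend:
  fixes T :: "('a::field ^ 'n) set"
  assumes "vec.subspace T" "vec.dim T = 2" "a \<in> T" "a \<noteq> 0"
  obtains b where "b \<in> T" "b \<notin> vec.span {a}" "T = vec.span {a, b}"
proof -
  have "\<not> T \<subseteq> vec.span {a}"
  proof
    assume "T \<subseteq> vec.span {a}"
    from vec.dim_mono[OF this] assms show False by simp
  qed
  then obtain b where "b \<in> T" "b \<notin> vec.span {a}" by blast
  thus thesis using that dim_2_span assms by blast
qed

lemma independent_pair:
  fixes a b :: "'a::field ^ 'n"
  assumes "a \<noteq> 0" "b \<notin> vec.span {a}" "t *s a + u *s b = t' *s a + u' *s b"
  shows "t = t'" "u = u'"
proof -
  have e: "(t - t') *s a = (u' - u) *s b"
    using assms(3) by (simp add: vec.scale_left_diff_distrib algebra_simps)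
  show u: "u = u'"
  proof (rule ccontr)
    assume n: "u \<noteq> u'"
    have "b = (1 / (u' - u)) *s ((u' - u) *s b)" using n by simp
    also have "\<dots> = ((t - t') / (u' - u)) *s a" unfolding e[symmetric] by simp
    finally have "b = ((t - t') / (u' - u)) *s a" .
    hence "b \<in> vec.span {a}" unfolding vec.span_singleton by blast
    thus False using assms(2) by simp
  qed
  show "t = t'" using e u assms(1) by simp
qed

lemma card_dim_2:
  fixes T :: "('a::{field,finite} ^ 'n) set"
  assumes "vec.subspace T" "vec.dim T = 2"
  shows "card T = CARD('a)\<^sup>2"
proof -
  have "\<not> T \<subseteq> {0}" using assms(2) vec.dim_eq_0[of T] by linarith
  then obtain a where a: "a \<in> T" "a \<noteq> 0" by blast
  obtain b where b: "b \<notin> vec.span {a}" "T = vec.span {a, b}" using dim_2_extend[OF assms a] by metis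
  let ?f = "\<lambda>(t, u). t *s a + u *s b"
  have "T = ?f ` (UNIV \<times> UNIV)"
  proof
    show "T \<subseteq> ?f ` (UNIV \<times> UNIV)"
    proof
      fix x assume "x \<in> T"
      then obtain t u where "x = t *s a + u *s b" using b(2) in_span2E by metis
      thus "x \<in> ?f ` (UNIV \<times> UNIV)" by force
    qed
    show "?f ` (UNIV \<times> UNIV) \<subseteq> T" using b(2) in_span2I by auto
  qed
  moreover have "inj_on ?f (UNIV \<times> UNIV)"
    using independent_pair[OF a(2) b(1)] by (auto simp: inj_on_def)
  ultimately have "card T = card (UNIV \<times> UNIV :: ('a \<times> 'a) set)"
    using card_image by metis
  thus ?thesis by (simp only: card_cartesian_product power2_eq_square)
qed

context quadratic_space
begin

text \<open>A secant line through \<open>y\<^sub>0\<close> in direction \<open>d\<close> meets the conic \<open>Q = m\<close> once more, and the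
  tangent direction yields \<open>y\<^sub>0\<close> itself; so the conic is an image of the \<open>q + 1\<close> directions.\<close>

lemma anisotropic_norm_card_le:
  assumes T: "vec.subspace T" "vec.dim T = 2" and aniso: "\<And>y. y \<in> T \<Longrightarrow> Q y = 0 \<Longrightarrow> y = 0"
    and m: "m \<noteq> 0"
  shows "card {y \<in> T. Q y = m} \<le> CARD('a) + 1"
proof (cases "{y \<in> T. Q y = m} = {}")
  case False
  then obtain y0 where y0: "y0 \<in> T" "Q y0 = m" by blast
  have y0n: "y0 \<noteq> 0" using y0 m by auto
  obtain y1 where y1: "y1 \<in> T" "y1 \<notin> vec.span {y0}" "T = vec.span {y0, y1}"
    using dim_2_extend[OF T y0(1) y0n] .
  \<comment> \<open>One vector for each of the q + 1 one-dimensional subspaces of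
    \<open>T\<close>.\<close>
  let ?D = "insert y1 (range (\<lambda>t. y0 + t *s y1))"
  let ?f = "\<lambda>d. y0 - (B y0 d / Q d) *s d"
  have "{y \<in> T. Q y = m} \<subseteq> ?f ` ?D"
  proof
    fix y assume "y \<in> {y \<in> T. Q y = m}"
    hence y: "y \<in> T" "Q y = m" by auto
    then obtain a b where ab: "y = a *s y0 + b *s y1" using y1(3) in_span2E by metis
    show "y \<in> ?f ` ?D"
    proof (cases "y = y0")
      case True
      show ?thesis
      proof (cases "B y0 y1 = 0")
        case True
        thus ?thesis using \<open>y = y0\<close> by force
      next
        case False
        let ?d = "y0 + (- B y0 y0 / B y0 y1) *s y1"
        have "B y0 ?d = 0" using False by simp
        hence "y = ?f ?d" using \<open>y = y0\<close> by simp
        thus ?thesis by blast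
      qed
    next
      case False
      obtain d l where d: "d \<in> ?D" "y = y0 + l *s d"
      proof (cases "a = 1")
        case True
        thus thesis using that[of y1 b] ab by simp
      next
        case False
        have "y = y0 + (a - 1) *s (y0 + (b / (a - 1)) *s y1)"
          using ab False by (simp add: vec.scale_left_diff_distrib vec.scale_right_distrib)
        thus thesis using that by blast
      qed
      have "y - y0 \<noteq> 0" "y - y0 \<in> T" using False y y0 T by (auto intro: vec.subspace_diff)
      hence "Q (y - y0) \<noteq> 0" using aniso by blast
      hence ld: "l \<noteq> 0" "Q d \<noteq> 0" using d by auto
      have "l * (B y0 d + l * Q d) = 0"
        using y(2) y0(2) unfolding d(2) by (simp add: Q_add power2_eq_square algebra_simps)
      hence "l * Q d = - B y0 d" using ld(1) by (simp add: add_eq_0_iff)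
      hence "l = - (B y0 d / Q d)" using ld(2) by (simp add: field_simps)
      hence "y = ?f d" using d(2) by simp
      thus ?thesis using d(1) by blast
    qed
  qed
  hence "card {y \<in> T. Q y = m} \<le> card (?f ` ?D)" by (intro card_mono) auto
  also have "\<dots> \<le> card ?D" by (rule card_image_le) simp
  also have "\<dots> \<le> Suc (card (range (\<lambda>t. y0 + t *s y1)))" by (rule card_insert_le_m1) auto
  also have "\<dots> \<le> Suc (CARD('a))" by (simp add: card_image_le)
  finally show ?thesis by simp
next
  case True
  thus ?thesis by (simp only: card.empty)
qed

text \<open>The q^2 - 1 nonzero vectors of \<open>T\<close> are shared among q - 1 nonzero values,
  each taken at most q + 1 times; so no value can be taken less often.\<close>

lemma anisotropic_norm_card:
  assumes T: "vec.subspace T" "vec.dim T = 2" and aniso: "\<And>y. y \<in> T \<Longrightarrow> Q y = 0 \<Longrightarrow> y = 0"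
    and m: "m \<noteq> 0"
  shows "card {y \<in> T. Q y = m} \<ge> CARD('a) + 1"
proof -
  let ?S = "\<lambda>m. {y \<in> T. Q y = m}" and ?q = "CARD('a)"
  have q2: "?q \<ge> 2" using card_mono[of "UNIV :: 'a set" "{0, 1}"] by simp
  have "T = {0} \<union> ?S m \<union> (\<Union>m' \<in> UNIV - {0, m}. ?S m')"
    using aniso vec.subspace_0[OF T(1)] m by auto
  hence "card T = card ({0} \<union> ?S m \<union> (\<Union>m' \<in> UNIV - {0, m}. ?S m'))" by simp
  also have "\<dots> \<le> card ({0} \<union> ?S m) + card (\<Union>m' \<in> UNIV - {0, m}. ?S m')" by (rule card_Un_le)
  also have "\<dots> \<le> (1 + card (?S m)) + (\<Sum>m' \<in> UNIV - {0, m}. card (?S m'))"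
    using card_Un_le[of "{0}" "?S m"] by (intro add_mono card_UN_le) auto
  also have "(\<Sum>m' \<in> UNIV - {0, m}. card (?S m')) \<le> (\<Sum>m' \<in> UNIV - {0, m}. ?q + 1)"
    using anisotropic_norm_card_le[OF T aniso] by (intro sum_mono) auto
  also have "\<dots> = (?q - 2) * (?q + 1)" using m by (simp add: card_Diff_subset numeral_2_eq_2)
  finally have "?q\<^sup>2 \<le> 1 + card (?S m) + (?q - 2) * (?q + 1)"
    using card_dim_2[OF T] by simp
  moreover obtain n where "?q = n + 2" using q2 by (metis add.commute le_Suc_ex)
  ultimately show ?thesis by (simp add: power2_eq_square algebra_simps)
qed

end

section \<open>The affine quadrangle in normalized vectors\<close>

locale affine_quadric = elliptic_space Q for Q :: "'a::{field,finite} ^ 6 \<Rightarrow> 'a" +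
  fixes p :: "'a ^ 6"
  assumes Qp: "Q p \<noteq> 0"
begin

abbreviation s where "s \<equiv> Q p"

text \<open>The hyperplane is \<open>p\<^sup>\<bottom>\<close>; every point of the quadric off it has a unique representative in
  the following set, and the reflection with centre \<open>p\<close> acts on these representatives as
  \<open>x \<mapsto> p - x\<close>.\<close>

definition aff :: "('a ^ 6) set" where
  "aff = {v. Q v = 0 \<and> B p v = s}"

text \<open>For \<open>x\<close> and \<open>y\<close> not equal and not twins this says that the ovoids subtended by \<open>x\<close> and
  \<open>y\<close> lie in a common rosette.\<close>

definition near :: "'a ^ 6 \<Rightarrow> 'a ^ 6 \<Rightarrow> bool" where
  "near x y \<longleftrightarrow> B x y = 0 \<or> B x y = s"

lemma affI: "Q x = 0 \<Longrightarrow> B p x = s \<Longrightarrow> x \<in> aff"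
  by (simp add: aff_def)

lemma affD [simp]:
  assumes "x \<in> aff"
  shows "Q x = 0" "B p x = s" "B x p = s" "B x x = 0"
proof -
  show 1: "Q x = 0" and 2: "B p x = s" using assms by (simp_all add: aff_def)
  show "B x p = s" using 2 by (subst B_sym)
  show "B x x = 0" using 1 by (simp add: B_self)
qed

lemma aff_nonzero: "x \<in> aff \<Longrightarrow> x \<noteq> 0"
proof
  assume "x \<in> aff" "x = 0"
  with affD(2) have "B p 0 = s" by blast
  thus False using Qp by simp
qed

lemma twin_aff [simp]: "x \<in> aff \<Longrightarrow> p - x \<in> aff"
  by (rule affI) (simp_all add: Q_diff B_self)

lemma B_twin [simp]:
  "x \<in> aff \<Longrightarrow> y \<in> aff \<Longrightarrow> B (p - x) y = s - B x y"
  "x \<in> aff \<Longrightarrow> y \<in> aff \<Longrightarrow> B x (p - y) = s - B x y"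
  by simp_all

lemma near_sym: "near x y \<longleftrightarrow> near y x"
  by (simp add: near_def B_sym[of x y])

lemma near_twin [simp]:
  assumes "x \<in> aff" "y \<in> aff"
  shows "near (p - x) y \<longleftrightarrow> near x y" "near x (p - y) \<longleftrightarrow> near x y"
  using assms by (auto simp: near_def)

lemma near_refl [simp]: "x \<in> aff \<Longrightarrow> near x x"
  by (simp add: near_def)

lemma near_twin_self [simp]: "x \<in> aff \<Longrightarrow> near x (p - x)" "x \<in> aff \<Longrightarrow> near (p - x) x"
  by (simp_all add: near_def)

lemma aff_independent:
  assumes "a \<in> aff" "b \<in> aff" "a \<noteq> b"
  shows "b \<notin> vec.span {a}"
proof
  assume "b \<in> vec.span {a}"
  then obtain t where t: "b = t *s a" by (rule in_span1E)
  have "t * s = s" using assms affD(2)[of b] affD(2)[of a] unfolding t by simp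
  hence "t = 1" using Qp by simp
  thus False using t assms by simp
qed

lemma aff_line_point:
  assumes "a \<in> aff" "b \<in> aff" "B a b = 0"
  shows "a + t *s (b - a) \<in> aff"
  using assms B_sym[of b a] by (intro affI) (simp_all add: Q_add Q_diff algebra_simps)

text \<open>The normalization forces the two coefficients to sum to 1, so the representatives on a
  line form an affine line.\<close>

lemma aff_span2:
  assumes "a \<in> aff" "b \<in> aff" "x \<in> aff" "x \<in> vec.span {a, b}"
  obtains t where "x = a + t *s (b - a)"
proof -
  obtain t u where x: "x = t *s a + u *s b" using assms in_span2E by metis
  have "(t + u) * s = s" using assms affD(2)[of x] affD(2)[of a] affD(2)[of b]
    unfolding x by (simp add: algebra_simps)
  hence "t = 1 - u" using Qp by (simp add: eq_diff_eq)
  hence "x = a + u *s (b - a)" using x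
    by (simp add: vec.scale_left_diff_distrib vec.scale_right_diff_distrib)
  thus thesis by (rule that)
qed

lemma aff_no_triangle:
  assumes "a \<in> aff" "b \<in> aff" "x \<in> aff" "B a b = 0" "B a x = 0" "B b x = 0" "a \<noteq> b"
  obtains t where "x = a + t *s (b - a)"
proof -
  have "x \<in> vec.span {a, b}"
    using assms aff_independent aff_nonzero by (intro no_triangle) auto
  thus thesis using aff_span2 assms that by metis
qed

end

section \<open>Common neighbours of two points\<close>

locale far_pair = affine_quadric Q p
  for Q :: "'a::{field,finite} ^ 6 \<Rightarrow> 'a" and p +
  fixes u w :: "'a ^ 6"
  assumes u [simp]: "u \<in> aff" and w [simp]: "w \<in> aff" and far: "\<not> near u w"
begin

definition c where "c = B u w"
text \<open>The common value of \<open>Q ctr\<close> and of \<open>B ctr v\<close> for all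
  \<open>v\<close> in \<open>common\<close>; their equality is what makes \<open>ctr - v\<close>
  singular.\<close>

definition k where "k = s * c / (c - s)"

text \<open>The projection of \<open>p\<close> to \<open>\<langle>u, w\<rangle>\<^sup>\<bottom>\<close>, scaled so that the reflection with this centre acts on
  the set \<open>common\<close> below as \<open>v \<mapsto> ctr - v\<close>.\<close>

definition ctr where "ctr = (1 / (c - s)) *s (c *s p - s *s (u + w))"

text \<open>Up to twins and moves along lines through \<open>u\<close>, every common neighbour can
  be replaced by a vector of this set, see \<open>reduce_to_common\<close>. It contains no two
  twins, because \<open>B u (p - v) = s\<close>.\<close>

definition common where "common = {v \<in> aff. B u v = 0 \<and> B w v = 0}"

abbreviation opp where "opp v \<equiv> ctr - v"

lemma c_nz: "c \<noteq> 0" "c \<noteq> s" "c - s \<noteq> 0"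
  using far by (auto simp: near_def c_def)

lemma Buw [simp]: "B u w = c" "B w u = c"
  using B_sym[of u w] by (auto simp: c_def)

lemma k_nz: "k \<noteq> 0"
  using c_nz Qp by (simp add: k_def)

lemma commonD [simp]:
  assumes "v \<in> common"
  shows "v \<in> aff" "B u v = 0" "B w v = 0" "B v u = 0" "B v w = 0"
  using assms B_sym[of u v] B_sym[of w v] by (auto simp: common_def)

lemma commonI: "v \<in> aff \<Longrightarrow> B u v = 0 \<Longrightarrow> B w v = 0 \<Longrightarrow> v \<in> common"
  unfolding common_def by blast

lemma ctr_B [simp]:
  "B u ctr = 0" "B w ctr = 0" "B p ctr = 2 * s"
  "v \<in> common \<Longrightarrow> B v ctr = k" "v \<in> common \<Longrightarrow> B ctr v = k"
proof -
  show "B u ctr = 0" "B w ctr = 0" by (simp_all add: ctr_def)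
  have "c * (2 * s) - s * (s + s) = 2 * s * (c - s)" by (simp add: algebra_simps)
  thus "B p ctr = 2 * s" using c_nz(3) by (simp add: ctr_def B_self)
  show "v \<in> common \<Longrightarrow> B v ctr = k" "v \<in> common \<Longrightarrow> B ctr v = k"
    by (simp_all add: ctr_def k_def)
qed

lemma Q_ctr: "Q ctr = k"
proof -
  have "Q (c *s p - s *s (u + w)) = c * s * (c - s)"
    by (simp add: Q_diff Q_add power2_eq_square algebra_simps)
  hence "Q ctr = (1 / (c - s))\<^sup>2 * (c * s * (c - s))"
    unfolding ctr_def Q_scale by simp
  thus ?thesis using c_nz(3) by (simp add: k_def power2_eq_square)
qed

lemma opp_common [simp]: "v \<in> common \<Longrightarrow> opp v \<in> common"
  by (intro commonI affI) (simp_all add: Q_diff Q_ctr)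

text \<open>Otherwise \<open>u\<close>, \<open>v\<close>, \<open>x\<close> would lie on a line. As
  \<open>B w\<close> is \<open>c\<close> at \<open>u\<close> and 0 at \<open>v\<close>, that line
  has only one vector orthogonal to \<open>w\<close>.\<close>

lemma common_coclique:
  assumes "v \<in> common" "x \<in> common" "B v x = 0"
  shows "x = v"
proof (rule ccontr)
  assume "x \<noteq> v"
  have "u \<noteq> v" using assms(1) c_nz Buw(2) commonD(3) by metis
  then obtain t where t: "x = u + t *s (v - u)"
    using assms by (elim aff_no_triangle[of u v x, rotated -1]) auto
  have "B w x = c - t * c" using assms(1) by (simp add: t)
  hence "c * (1 - t) = 0" using assms(2) by (simp add: algebra_simps)
  hence "t = 1" using c_nz by simp
  thus False using t \<open>x \<noteq> v\<close> by simp
qed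

text \<open>Makes \<open>p\<close>, \<open>v\<close>, \<open>w\<close>, \<open>u\<close>
  independent, so that their perpendicular space is a plane.\<close>

lemma common_independent:
  assumes "v \<in> common"
  shows "w \<notin> vec.span {u}" "v \<notin> vec.span {w, u}" "p \<notin> vec.span {v, w, u}"
proof -
  have "u \<noteq> w" using far by auto
  thus "w \<notin> vec.span {u}" by (intro aff_independent) auto
  show "v \<notin> vec.span {w, u}"
  proof
    assume "v \<in> vec.span {w, u}"
    then obtain a b where ab: "v = a *s w + b *s u" by (rule in_span2E)
    have "a * c = 0" using commonD(2)[OF assms] by (simp add: ab)
    moreover have "b * c = 0" using commonD(3)[OF assms] by (simp add: ab)
    ultimately have "v = 0" using c_nz ab by simp
    thus False using aff_nonzero assms commonD(1) by blast
  qed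
  show "p \<notin> vec.span {v, w, u}"
  proof
    assume "p \<in> vec.span {v, w, u}"
    hence "B p v = 0" by (rule span_perp[rotated]) (use assms in auto)
    thus False using Qp assms by simp
  qed
qed

definition base where "base v = {p, v, w, u}"

text \<open>Since \<open>v + opp v = ctr\<close> is a combination of \<open>p\<close>,
  \<open>u\<close>, \<open>w\<close>, this is the complement of the hyperbolic plane of
  \<open>v\<close> and \<open>opp v\<close> inside the space orthogonal to \<open>u\<close> and
  \<open>w\<close>. It supplies the coordinates for counting in \<open>common\<close>.\<close>

definition residual where "residual v = perp_space (base v)"

lemma residualD:
  assumes "y \<in> residual v"
  shows "B p y = 0" "B y p = 0" "B v y = 0" "B y v = 0" "B w y = 0" "B y w = 0" "B u y = 0" "B y u = 0"
    "B ctr y = 0" "B y ctr = 0"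
proof -
  show 1: "B p y = 0" "B v y = 0" "B w y = 0" "B u y = 0"
    using assms by (auto simp: residual_def base_def perp_space_def)
  show 2: "B y p = 0" "B y v = 0" "B y w = 0" "B y u = 0"
    using 1 by (auto simp: B_sym[of y])
  show "B ctr y = 0" using 1 by (simp add: ctr_def)
  show "B y ctr = 0" using 2 by (simp add: ctr_def)
qed

lemma residualI: "B p y = 0 \<Longrightarrow> B v y = 0 \<Longrightarrow> B w y = 0 \<Longrightarrow> B u y = 0 \<Longrightarrow> y \<in> residual v"
  by (auto simp: residual_def base_def perp_space_def)

lemma residual_dim:
  assumes "v \<in> common"
  shows "vec.dim (residual v) = 2"
proof -
  have "u \<notin> vec.span {}" using aff_nonzero by simp
  note dim_perp_insert[OF this] common_independent[OF assms, THEN dim_perp_insert]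
  thus ?thesis using dim_perp_empty by (simp add: residual_def base_def)
qed

lemma residual_subspace: "vec.subspace (residual v)"
  unfolding residual_def by (rule subspace_perp)

text \<open>A singular \<open>y\<close> would be orthogonal to the line through \<open>u\<close> and
  \<open>v\<close>, hence lie on it; orthogonality to \<open>w\<close> and \<open>p\<close> then
  removes both coefficients.\<close>

lemma residual_anisotropic:
  assumes v: "v \<in> common" and y: "y \<in> residual v" "Q y = 0"
  shows "y = 0"
proof -
  note [simp] = residualD[OF y(1)]
  have "u \<noteq> v" using v c_nz Buw(2) commonD(3) by metis
  hence "y \<in> vec.span {u, v}"
    using v y aff_nonzero aff_independent[of u v] by (intro no_triangle) auto
  then obtain a b where ab: "y = a *s u + b *s v" by (rule in_span2E)
  have "a * c = 0" using residualD(5)[OF y(1)] v by (simp add: ab)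
  hence a: "a = 0" using c_nz by simp
  have "b * s = 0" using residualD(1)[OF y(1)] v a by (simp add: ab)
  thus ?thesis using a ab Qp by simp
qed

text \<open>Here \<open>v\<close> is orthogonal to the twin of \<open>x\<close>. By
  \<open>common_coclique\<close> this is the only way in which distinct members of
  \<open>common\<close> can be near.\<close>

definition step where "step v = {x \<in> common. B v x = s}"

lemma step_sym: "x \<in> step v \<Longrightarrow> v \<in> common \<Longrightarrow> v \<in> step x"
  by (simp add: step_def B_sym[of x])

lemma step_common: "x \<in> step v \<Longrightarrow> x \<in> common"
  by (simp add: step_def)

text \<open>Write \<open>x\<close> as \<open>(1 - b) *s v + b *s opp v + y\<close> with
  \<open>y\<close> in \<open>residual v\<close>. The condition \<open>B v x = s\<close> fixes
  \<open>b\<close>, and \<open>Q x = 0\<close> then prescribes a nonzero value of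
  \<open>Q y\<close>; \<open>anisotropic_norm_card\<close> counts the solutions.\<close>

lemma step_card:
  assumes v: "v \<in> common"
  shows "card (step v) \<ge> CARD('a) + 1"
proof -
  \<comment> \<open>Chosen so that \<open>(1 - ?r) * k = s\<close>; then \<open>?m\<close> equals
    \<open>- (?r * (1 - ?r) * k)\<close>.\<close>
  let ?r = "s / c"
  let ?m = "- (s * s / c)"
  let ?f = "\<lambda>y. ?r *s v + (1 - ?r) *s opp v + y"
  have "?f ` {y \<in> residual v. Q y = ?m} \<subseteq> step v"
  proof (rule image_subsetI)
    fix y assume "y \<in> {y \<in> residual v. Q y = ?m}"
    hence y: "y \<in> residual v" "Q y = ?m" by auto
    note [simp] = residualD[OF y(1)]
    have "Q (?f y) = ?r * (1 - ?r) * k + Q y"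
      using v opp_common[OF v] by (simp add: Q_add del: B_diff) (simp add: algebra_simps)
    also have "\<dots> = 0"
    proof -
      have "1 - ?r = (c - s) / c" using c_nz(1) by (simp add: diff_divide_distrib)
      thus ?thesis using c_nz(1,3) y(2) by (simp add: k_def)
    qed
    finally have "Q (?f y) = 0" .
    moreover have "B p (?f y) = s" using v by (simp, simp add: algebra_simps)
    ultimately have aff: "?f y \<in> aff" by (rule affI)
    have "?f y \<in> common" by (rule commonI[OF aff]) (use v in simp_all)
    moreover have "B v (?f y) = (1 - ?r) * k" using v by simp
    moreover have "(1 - ?r) * k = s"
    proof -
      have "1 - ?r = (c - s) / c" using c_nz(1) by (simp add: diff_divide_distrib)
      thus ?thesis using c_nz(1,3) by (simp add: k_def)
    qed
    ultimately show "?f y \<in> step v" by (simp only: step_def mem_Collect_eq)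
  qed
  hence "card (?f ` {y \<in> residual v. Q y = ?m}) \<le> card (step v)" by (intro card_mono) auto
  moreover have "card (?f ` {y \<in> residual v. Q y = ?m}) = card {y \<in> residual v. Q y = ?m}"
    by (rule card_image) (auto simp: inj_on_def)
  moreover have "card {y \<in> residual v. Q y = ?m} \<ge> CARD('a) + 1"
    using residual_subspace residual_dim[OF v] residual_anisotropic[OF v] Qp c_nz
    by (intro anisotropic_norm_card) auto
  ultimately show ?thesis by simp
qed

text \<open>Stereographic projection from \<open>v\<close>: in the coordinates of
  \<open>step_card\<close>, the vector \<open>h x\<close> is \<open>y\<close> divided by
  \<open>b\<close>, and \<open>Q (h x) = k - k / b\<close>. So \<open>h x\<close> determines
  \<open>b\<close> and then \<open>x\<close>, which leaves q^2 possibilities besides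
  \<open>v\<close>.\<close>

lemma common_card:
  assumes v: "v \<in> common"
  shows "card common \<le> CARD('a)\<^sup>2 + 1"
proof -
  define b where "b x = B v x / k" for x
  define y where "y x = x - (1 - b x) *s v - b x *s opp v" for x
  define h where "h x = (1 / b x) *s y x" for x
  have b: "b x \<noteq> 0" if "x \<in> common - {v}" for x
    using that common_coclique[OF v] k_nz by (auto simp: b_def)
  have y: "y x \<in> residual v" if "x \<in> common" for x
    using that v k_nz
    by (intro residualI; simp add: y_def) (simp_all add: b_def algebra_simps)
  have Qy: "Q (y x) = - ((1 - b x) * b x * k)" if x: "x \<in> common" for x
  proof -
    note [simp] = residualD[OF y[OF x]]
    have "x = (1 - b x) *s v + b x *s opp v + y x" by (simp add: y_def)
    hence "Q x = Q ((1 - b x) *s v + b x *s opp v + y x)" by simp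
    also have "\<dots> = (1 - b x) * b x * k + Q (y x)"
      using v opp_common[OF v] by (simp add: Q_add del: B_diff) (simp add: algebra_simps)
    finally show ?thesis using x by (simp add: add_eq_0_iff)
  qed
  have Qh: "Q (h x) = k - k / b x" if "x \<in> common - {v}" for x
    using Qy[of x] b[OF that] that by (simp add: h_def power2_eq_square field_simps)
  have "inj_on h (common - {v})"
  proof (rule inj_onI)
    fix x x' assume x: "x \<in> common - {v}" "x' \<in> common - {v}" and eq: "h x = h x'"
    have "k - k / b x = k - k / b x'" using Qh[OF x(1)] Qh[OF x(2)] eq by metis
    hence bb: "b x = b x'" using k_nz by auto
    hence "y x = y x'" using eq b[OF x(2)] by (simp add: h_def)
    thus "x = x'" using bb by (simp add: y_def)
  qed
  moreover have "h ` (common - {v}) \<subseteq> residual v"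
    using y by (auto simp: h_def intro!: vec.subspace_scale residual_subspace)
  ultimately have "card (common - {v}) \<le> card (residual v)" by (intro card_inj_on_le) auto
  also have "\<dots> = CARD('a)\<^sup>2" by (rule card_dim_2[OF residual_subspace residual_dim[OF v]])
  finally show ?thesis using v by (simp add: card_Diff_singleton_if)
qed

text \<open>Five independent linear conditions leave an affine line, which would be totally singular
  if it contained three singular vectors.\<close>

lemma step_section_card:
  assumes v: "v \<in> common" and e: "e \<notin> vec.span (base v)"
  shows "card {x \<in> step v. B e x = t} \<le> 2"
proof -
  let ?X = "{x \<in> step v. B e x = t}"
  have "?X \<subseteq> {x0, x1}" if x01: "x0 \<in> ?X" "x1 \<in> ?X" "x0 \<noteq> x1" for x0 x1
  proof
    fix x2 assume x2: "x2 \<in> ?X"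
    let ?d = "x1 - x0"
    have diff: "x - y \<in> perp_space (insert e (base v))" if "x \<in> ?X" "y \<in> ?X" for x y
      using that by (auto simp: perp_space_def base_def step_def)
    have "vec.dim (perp_space (insert e (base v))) = 1"
      using dim_perp_insert[OF e] residual_dim[OF v] by (simp add: residual_def)
    hence "perp_space (insert e (base v)) = vec.span {?d}"
      using x01 diff by (intro dim_1_span subspace_perp) auto
    then obtain r where r: "x2 - x0 = r *s ?d"
      using diff[OF x2 x01(1)] in_span1E by metis
    hence x2_eq: "x2 = x0 + r *s ?d" by (metis add.commute diff_add_cancel)
    have c: "x0 \<in> common" "x1 \<in> common" "x2 \<in> common" using x01 x2 by (auto simp: step_def)
    have Bx: "B x0 x1 \<noteq> 0" using common_coclique[of x0 x1] c x01(3) by metis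
    have "Q x2 = r * B x0 x1 - r * r * B x0 x1"
      using c B_sym[of x1 x0] by (simp add: x2_eq Q_add Q_diff power2_eq_square algebra_simps)
    hence "r * (1 - r) * B x0 x1 = 0" using c by (simp add: algebra_simps)
    hence "r = 0 \<or> r = 1" using Bx by simp
    thus "x2 \<in> {x0, x1}" using x2_eq by auto
  qed
  hence two: "card ?X \<le> 2" if "x0 \<in> ?X" "x1 \<in> ?X" "x0 \<noteq> x1" for x0 x1
    using card_mono[of "{x0, x1}" ?X] that by auto
  show ?thesis
  proof (cases "\<forall>x0 \<in> ?X. \<forall>x1 \<in> ?X. x0 = x1")
    case True
    hence "card ?X \<le> Suc 0" by (subst card_le_Suc0_iff_eq) auto
    thus ?thesis by simp
  qed (use two in blast)
qed

text \<open>The vectors of the span that are orthogonal to \<open>u\<close> and \<open>w\<close>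
  form the hyperbolic plane of \<open>v\<close> and \<open>opp v\<close>, whose only singular points
  are these two. This permits \<open>step_section_card\<close> with \<open>e = x\<close>, which
  bounds the number of common steps of \<open>v\<close> and \<open>x\<close>.\<close>

lemma common_not_in_span_base:
  assumes v: "v \<in> common" and x: "x \<in> common" "x \<noteq> v" "x \<noteq> opp v"
  shows "x \<notin> vec.span (base v)"
proof
  assume "x \<in> vec.span (base v)"
  then obtain d g y where y: "y \<in> vec.span {w, u}" and x_eq': "x = d *s p + (g *s v + y)"
    unfolding base_def by (elim in_span_insertE[of x p] in_span_insertE[of _ v]) blast
  obtain b a where "y = b *s w + a *s u" using in_span2E[OF y] .
  hence x_eq: "x = d *s p + (g *s v + (b *s w + a *s u))" using x_eq' by simp
  have "d * s + b * c = 0" using commonD(2)[OF x(1)] v unfolding x_eq by simp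
  hence b: "b = - (d * s / c)" using c_nz by (simp add: field_simps add_eq_0_iff)
  have "d * s + a * c = 0" using commonD(3)[OF x(1)] v unfolding x_eq by simp
  hence a: "a = - (d * s / c)" using c_nz by (simp add: field_simps add_eq_0_iff)
  define r where "r = s / c"
  have rc: "r * c = s" using c_nz by (simp add: r_def)
  have ar: "a = - (d * r)" "b = - (d * r)" using a b by (simp_all add: r_def)
  have xa: "x \<in> aff" using x by simp
  have "(2 * d + g + b + a) * s = s"
    using affD(2)[OF xa] v unfolding x_eq by (simp add: B_self algebra_simps)
  hence sum: "2 * d + g + b + a = 1" using Qp by simp
  hence "g = 1 - 2 * d - b - a" by (simp add: algebra_simps)
  hence g: "g = 1 - 2 * d * (1 - s / c)" unfolding ar r_def by (simp add: algebra_simps)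
  have "Q x = d * (d * s) + d * s * (g + b + a) + a * b * c"
    using v unfolding x_eq by (simp add: Q_add power2_eq_square algebra_simps)
  also have "g + b + a = 1 - 2 * d" using sum by (simp add: algebra_simps)
  also have "a * b * c = d * d * r * s" unfolding ar using rc by (simp add: mult.assoc)
  also have "d * (d * s) + d * s * (1 - 2 * d) + d * d * r * s = d * s * (1 - d * (1 - s / c))"
    unfolding r_def by (simp add: algebra_simps)
  finally have "d = 0 \<or> d * (1 - s / c) = 1" using xa Qp by simp
  thus False
  proof
    assume "d = 0"
    hence "x = v" using x_eq a b g by simp
    thus False using x by simp
  next
    assume d1: "d * (1 - s / c) = 1"
    have d: "d = (1 / (c - s)) * c" using d1 c_nz by (simp add: field_simps)
    have g1: "g = -1" using g d1 by (simp add: mult.assoc)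
    have ab: "a = - ((1 / (c - s)) * s)" "b = - ((1 / (c - s)) * s)" using a b d c_nz by simp_all
    have "x = opp v" unfolding x_eq g1 ab d ctr_def
      by (simp add: vec.scale_right_diff_distrib vec.scale_right_distrib)
    thus False using x by simp
  qed
qed

end

section \<open>Simple connectivity modulo two\<close>

context far_pair
begin

definition two_steps where "two_steps v = (\<Union>y \<in> step v. step y)"

text \<open>Counts the walks of length two from \<open>v\<close> by their endpoints: those ending neither in \<open>v\<close> nor in
  \<open>opp v\<close> are reached at most twice.\<close>

lemma two_steps_card:
  assumes v: "v \<in> common"
  shows "2 * card (two_steps v) \<ge> CARD('a)\<^sup>2 + 3"
proof -
  let ?q = "CARD('a)" and ?n = "card (step v)" and ?T = "two_steps v"
  let ?E = "{v, opp v} \<inter> ?T"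
  have n: "?n \<ge> ?q + 1" by (rule step_card[OF v])
  have "?n \<noteq> 0" using n by linarith
  then obtain y0 where y0: "y0 \<in> step v" by (metis card.empty ex_in_conv)
  have vT: "v \<in> ?T" using y0 step_sym[OF y0 v] by (auto simp: two_steps_def)
  have Tc: "?T \<subseteq> common" using step_common by (auto simp: two_steps_def)
  have opp_v: "opp v \<noteq> v"
  proof
    assume "opp v = v"
    hence "B v (opp v) = B v v" by simp
    thus False using v k_nz by simp
  qed
  have "?n * (?q + 1) \<le> (\<Sum>y \<in> step v. card (step y))"
    using sum_mono[of "step v" "\<lambda>_. ?q + 1" "\<lambda>y. card (step y)"] step_card step_common by simp
  also have "\<dots> = (\<Sum>y \<in> step v. \<Sum>x \<in> ?T. if x \<in> step y then 1 else 0)"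
  proof (rule sum.cong[OF refl])
    fix y assume "y \<in> step v"
    hence "{x \<in> ?T. x \<in> step y} = step y" by (auto simp: two_steps_def)
    thus "card (step y) = (\<Sum>x \<in> ?T. if x \<in> step y then 1 else 0)"
      by (simp add: sum.If_cases Int_def)
  qed
  also have "\<dots> = (\<Sum>x \<in> ?T. \<Sum>y \<in> step v. if x \<in> step y then 1 else 0)" by (rule sum.swap)
  also have "\<dots> = (\<Sum>x \<in> ?T. card {y \<in> step v. x \<in> step y})"
    by (simp add: sum.If_cases Int_def)
  also have "\<dots> = (\<Sum>x \<in> ?E. card {y \<in> step v. x \<in> step y})
      + (\<Sum>x \<in> ?T - ?E. card {y \<in> step v. x \<in> step y})"
    by (subst sum.union_disjoint[symmetric]) (auto intro: sum.cong)
  also have "(\<Sum>x \<in> ?E. card {y \<in> step v. x \<in> step y}) \<le> (\<Sum>x \<in> ?E. ?n)"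
    by (intro sum_mono card_mono) auto
  also have "(\<Sum>x \<in> ?T - ?E. card {y \<in> step v. x \<in> step y}) \<le> (\<Sum>x \<in> ?T - ?E. 2)"
  proof (intro sum_mono)
    fix x assume x: "x \<in> ?T - ?E"
    have "card {y \<in> step v. x \<in> step y} \<le> card {y \<in> step v. B x y = s}"
      by (intro card_mono) (auto simp: step_def B_sym[of x])
    also have "\<dots> \<le> 2"
      using x Tc by (intro step_section_card[OF v] common_not_in_span_base[OF v]) auto
    finally show "card {y \<in> step v. x \<in> step y} \<le> 2" .
  qed
  \<comment> \<open>The ends \<open>v\<close> and \<open>opp v\<close> are charged with all of
    \<open>step v\<close>, every other end with two walks. In the worst case both occur, and
    \<open>card (step v) \<ge> q + 1\<close> leaves
    \<open>2 * card ?T \<ge> (q + 1) * (q - 1) + 4\<close>.\<close>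
  finally have le: "?n * (?q + 1) \<le> card ?E * ?n + 2 * card (?T - ?E)" by simp
  have cardT: "card (?T - ?E) + card ?E = card ?T"
    by (subst card_Diff_subset) (auto simp: card_mono)
  have q2: "?q \<ge> 2" using card_mono[of "UNIV :: 'a set" "{0, 1}"] by simp
  then obtain i where i: "?q = i + 2" by (metis add.commute le_Suc_ex)
  obtain j where j: "?n = ?q + 1 + j" using n le_Suc_ex by blast
  show ?thesis
  proof (cases "opp v \<in> ?T")
    case True
    hence "?E = {v, opp v}" using vT by auto
    hence E2: "card ?E = 2" using opp_v by simp
    have "?n * (?q + 1) \<le> 2 * ?n + 2 * (card (?T - ?E))" using le E2 by simp
    thus ?thesis using cardT unfolding E2 i j
      by (simp add: power2_eq_square algebra_simps)
  next
    case False
    hence "?E = {v}" using vT by auto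
    hence E1: "card ?E = 1" by simp
    have "?n * (?q + 1) \<le> ?n + 2 * (card (?T - ?E))" using le E1 by simp
    thus ?thesis using cardT unfolding E1 i j
      by (simp add: power2_eq_square algebra_simps)
  qed
qed

text \<open>Each set reached in two steps has at least (q^2 + 3) / 2 of the at most q^2 + 1 members
  of \<open>common\<close>, so two such sets meet.\<close>

lemma common_connected:
  assumes "v \<in> common" "v' \<in> common"
  obtains y x y' where "y \<in> step v" "x \<in> step y" "y' \<in> step v'" "x \<in> step y'"
proof -
  have "two_steps v \<inter> two_steps v' \<noteq> {}"
  proof
    assume "two_steps v \<inter> two_steps v' = {}"
    hence "card (two_steps v) + card (two_steps v') = card (two_steps v \<union> two_steps v')"
      by (simp add: card_Un_disjoint)
    also have "\<dots> \<le> card common"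
      using step_common by (intro card_mono) (auto simp: two_steps_def)
    finally show False
      using two_steps_card[OF assms(1)] two_steps_card[OF assms(2)] common_card[OF assms(1)] by linarith
  qed
  thus thesis using that by (auto simp: two_steps_def)
qed

text \<open>As \<open>p\<close> is outside the span of \<open>u\<close> and \<open>w\<close>, some
  singular vector orthogonal to both is not orthogonal to \<open>p\<close> and can be normalized. If
  \<open>p\<close> were \<open>a *s w + b *s u\<close>, the values of \<open>B p u\<close>,
  \<open>B p w\<close> and \<open>Q p\<close> would force \<open>a = 1\<close> and
  \<open>c = s\<close>.\<close>

lemma common_nonempty: "common \<noteq> {}"
proof -
  have p: "p \<notin> vec.span {w, u}"
  proof
    assume "p \<in> vec.span {w, u}"
    then obtain a b where ab: "p = a *s w + b *s u" by (rule in_span2E)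
    have a: "a * c = s" using affD(2)[OF u] affD(3)[OF u] by (subst (asm) (2) ab) simp
    have b: "b * c = s" using affD(3)[OF w] by (subst (asm) (1) ab) simp
    have "Q (a *s w + b *s u) = a * b * c" by (simp add: Q_add)
    hence "s = a * (b * c)" using ab by (simp add: mult.assoc)
    hence "a = 1" using b Qp by simp
    thus False using a c_nz by simp
  qed
  have uw: "w \<notin> vec.span {u}" using far by (intro aff_independent) auto
  obtain y where y: "Q y = 0" "B u y = 0" "y \<notin> vec.span {u}"
    using singular_neighbour[of u] aff_nonzero by auto
  \<comment> \<open>Moves \<open>y\<close> along \<open>u\<close> until it is orthogonal to
    \<open>w\<close>; it stays singular because \<open>u\<close> is singular and orthogonal to
    \<open>y\<close>.\<close>
  define v where "v = y - (B w y / c) *s u"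
  have v: "Q v = 0" "B u v = 0" "B w v = 0"
    using y c_nz B_sym[of y u] by (simp_all add: v_def Q_diff)
  have "v \<notin> vec.span {w, u}"
  proof
    assume "v \<in> vec.span {w, u}"
    then obtain a b where ab: "v = a *s w + b *s u" by (rule in_span2E)
    have "a * c = 0" using v(2) by (simp add: ab)
    moreover have "b * c = 0" using v(3) by (simp add: ab)
    ultimately have "v = 0" using c_nz ab by simp
    hence "y = (B w y / c) *s u" by (simp add: v_def)
    thus False using y(3) unfolding vec.span_singleton by blast
  qed
  moreover have "v \<in> perp_space {w, u}" using v by (auto simp: perp_space_def)
  ultimately obtain d where d: "d \<in> perp_space {w, u}" "Q d = 0" "B p d \<noteq> 0"
    using singular_perp_exists v(1) p by blast
  have "(s / B p d) *s d \<in> common"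
    using d by (intro commonI affI) (auto simp: perp_space_def)
  thus ?thesis by blast
qed

end

section \<open>Cochains modulo two that are trivial on triangles\<close>

context affine_quadric
begin

text \<open>The \<open>\<int>/2\<close>-valued cochains on edges of the collinearity graph of the ovoid geometry which are
  trivial on all triangles.\<close>

definition triangle_additive :: "('a ^ 6 \<Rightarrow> 'a ^ 6 \<Rightarrow> bool) \<Rightarrow> bool" where
  "triangle_additive d \<longleftrightarrow> (\<forall>x \<in> aff. \<forall>y \<in> aff. \<forall>z \<in> aff.
     near x y \<longrightarrow> near y z \<longrightarrow> near x z \<longrightarrow> d x z = (d x y \<noteq> d y z))"

lemma triangle_additiveD:
  assumes "triangle_additive d" "x \<in> aff" "y \<in> aff" "z \<in> aff" "near x y" "near y z" "near x z"
  shows "d x z = (d x y \<noteq> d y z)"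
  using assms unfolding triangle_additive_def by blast

text \<open>The triangles \<open>u, v, v'\<close> and \<open>v, v', w\<close> share the edge
  \<open>v, v'\<close>, whose contribution cancels.\<close>

lemma common_neighbour_step:
  assumes "triangle_additive d" "u \<in> aff" "w \<in> aff" "v \<in> aff" "v' \<in> aff"
    and "near u v" "near v w" "near u v'" "near v' w" "near v v'"
  shows "(d u v \<noteq> d v w) = (d u v' \<noteq> d v' w)"
proof -
  have "d u v' = (d u v \<noteq> d v v')" "d v w = (d v v' \<noteq> d v' w)"
    using assms by (intro triangle_additiveD; simp)+
  thus ?thesis by auto
qed

end

context far_pair
begin

text \<open>Passing to a twin makes \<open>v\<close> orthogonal to \<open>u\<close>; moving along
  the line through \<open>u\<close> then makes it orthogonal to \<open>w\<close>. Either move joins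
  near vectors, so \<open>common_neighbour_step\<close> keeps the value.\<close>

lemma reduce_to_common:
  assumes d: "triangle_additive d" and v: "v \<in> aff" "near u v" "near v w"
  obtains v0 where "v0 \<in> common" "(d u v0 \<noteq> d v0 w) = (d u v \<noteq> d v w)"
proof -
  define v1 where "v1 = (if B u v = 0 then v else p - v)"
  have v1: "v1 \<in> aff" "B u v1 = 0" "near v1 w" "near v v1"
    using v by (auto simp: v1_def near_def)
  have 1: "(d u v \<noteq> d v w) = (d u v1 \<noteq> d v1 w)"
    using d v v1 by (intro common_neighbour_step) (auto simp: near_def)
  \<comment> \<open>The coefficient solves \<open>c + t * (s - c) = 0\<close>, since
    \<open>B w\<close> is \<open>c\<close> at \<open>u\<close> and \<open>s\<close> at
    \<open>v1\<close>.\<close>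
  define v2 where "v2 = (if B w v1 = 0 then v1 else u + (c / (c - s)) *s (v1 - u))"
  have v2: "v2 \<in> aff" using v1 aff_line_point[of u v1] by (simp add: v2_def)
  have B: "B u v2 = 0" "B v1 v2 = 0"
    using v1 B_sym[of v1 u] by (auto simp: v2_def)
  have "B w v2 = 0"
  proof (cases "B w v1 = 0")
    case False
    hence "B w v1 = s" using v1(3) B_sym[of w v1] by (auto simp: near_def)
    moreover have "c + (c / (c - s)) * (s - c) = 0" using c_nz by (simp add: field_simps)
    ultimately show ?thesis using False by (simp add: v2_def)
  qed (simp add: v2_def)
  moreover from this have "near v2 w" by (simp add: near_def B_sym[of v2 w])
  moreover have "near u v1" "near u v2" "near v1 v2" using B v1 by (simp_all add: near_def)
  ultimately show thesis
    using 1 v1 v2 B common_neighbour_step[OF d u w v1(1) v2]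
    by (intro that[of v2] commonI) auto
qed

text \<open>Both middle vertices are replaced by members of \<open>common\<close>, which are joined
  by four steps; each step shifts the path across two triangles.\<close>

lemma common_neighbours_agree:
  assumes d: "triangle_additive d"
    and v: "v \<in> aff" "near u v" "near v w" and v': "v' \<in> aff" "near u v'" "near v' w"
  shows "(d u v \<noteq> d v w) = (d u v' \<noteq> d v' w)"
proof -
  have 1: "(d u x \<noteq> d x w) = (d u y \<noteq> d y w)" if "x \<in> common" "y \<in> step x" for x y
    using that step_common[OF that(2)]
    by (intro common_neighbour_step[OF d]) (auto simp: near_def step_def)
  obtain x where x: "x \<in> common" "(d u x \<noteq> d x w) = (d u v \<noteq> d v w)"
    using reduce_to_common[OF d v] by metis
  obtain x' where x': "x' \<in> common" "(d u x' \<noteq> d x' w) = (d u v' \<noteq> d v' w)"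
    using reduce_to_common[OF d v'] by metis
  obtain y z y' where "y \<in> step x" "z \<in> step y" "y' \<in> step x'" "z \<in> step y'"
    using common_connected[OF x(1) x'(1)] .
  thus ?thesis using 1[of x y] 1[of y z] 1[of x' y'] 1[of y' z] x x' step_common by metis
qed

text \<open>The pentagon \<open>u, v, w, w', v'\<close> is cut by the edge \<open>v, v'\<close> into a triangle and a quadrangle.\<close>

lemma shortcut:
  assumes w': "w' \<in> aff" and far': "\<not> near u w'" and ww': "B w w' = 0"
  obtains v v' where "v \<in> aff" "v' \<in> aff" "near u v" "near v w" "near u v'" "near v' w'" "near v v'"
proof (cases "w = w'")
  case True
  obtain v where "v \<in> common" using common_nonempty by blast
  hence "v \<in> aff" "near u v" "near v w" by (auto simp: near_def)
  thus thesis using that[of v v] True by simp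
next
  case False
  have c': "B u w' \<noteq> 0" "B u w' \<noteq> s" using far' by (auto simp: near_def)
  show thesis
  proof (cases "B u w' = c")
    case False
    \<comment> \<open>Solves \<open>c + t * (B u w' - c) = 0\<close>: the vector on the line of
      \<open>w\<close> and \<open>w'\<close> that is orthogonal to \<open>u\<close> serves as both
      \<open>v\<close> and \<open>v'\<close>.\<close>
    define t where "t = c / (c - B u w')"
    define v where "v = w + t *s (w' - w)"
    have "v \<in> aff" using w' ww' by (simp add: v_def aff_line_point)
    moreover have "c - B u w' \<noteq> 0" using False by simp
    hence "c + t * (B u w' - c) = 0" unfolding t_def by (simp add: field_simps)
    hence "B u v = 0" by (simp add: v_def)
    moreover have "B v w = 0" "B v w' = 0" using ww' w' B_sym[of w' w] by (simp_all add: v_def)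
    ultimately show thesis using that[of v v] by (auto simp: near_def)
  next
    case True
    obtain v0 where v0: "v0 \<in> common" using common_nonempty by blast
    \<comment> \<open>Here \<open>B u\<close> is constant on the line of \<open>w\<close> and
      \<open>w'\<close>, so a line through \<open>u\<close> is chosen instead: if
      \<open>B w' v \<noteq> c\<close>, the line of \<open>u\<close> and \<open>v\<close> has a
      vector orthogonal to \<open>w'\<close>. Were there no such \<open>v\<close>, all of
      \<open>step v0\<close>, at least three vectors, would satisfy one further linear equation,
      which at most two can do.\<close>
    have "\<exists>v \<in> common. B w' v \<noteq> c"
    proof (rule ccontr)
      assume "\<not> ?thesis"
      hence all: "B w' v = c" if "v \<in> common" for v using that by blast
      have "w' \<notin> vec.span (base v0)"
      proof
        assume "w' \<in> vec.span (base v0)"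
        then obtain d g y where y: "y \<in> vec.span {w, u}" and x_eq': "w' = d *s p + (g *s v0 + y)"
          unfolding base_def by (elim in_span_insertE[of w' p] in_span_insertE[of _ v0]) blast
        obtain b a where "y = b *s w + a *s u" using in_span2E[OF y] .
        hence x_eq: "w' = d *s p + (g *s v0 + (b *s w + a *s u))" using x_eq' by simp
        have "d * s = c" using all[OF v0] v0 unfolding x_eq by simp
        hence ds: "d * s = c" .
        have "d * s + b * c = c" using True v0 unfolding x_eq by simp
        hence b: "b = 0" using ds c_nz by simp
        have "d * s + a * c = 0" using ww' v0 unfolding x_eq by simp
        hence "(1 + a) * c = 0" using ds by (simp add: algebra_simps)
        hence a: "a = -1" using c_nz by (simp add: add_eq_0_iff)
        have "(2 * d + g - 1) * s = s"
          using affD(2)[OF w'] v0 unfolding x_eq a b by (simp add: B_self algebra_simps)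
        hence "2 * d + g - 1 = 1" using Qp by simp
        hence g: "g = 2 - 2 * d" by (simp add: algebra_simps)
        have "Q w' = d * (d * s) + d * s * (g - 1)"
          using v0 unfolding x_eq a b by (simp add: Q_add Q_diff power2_eq_square algebra_simps)
        also have "\<dots> = d * s * (1 - d)" unfolding g by (simp add: algebra_simps)
        finally have "d * s * (1 - d) = 0" using w' by simp
        hence "d = 1" using ds c_nz by simp
        thus False using ds c_nz by simp
      qed
      hence "card {x \<in> step v0. B w' x = c} \<le> 2" by (rule step_section_card[OF v0])
      moreover have "{x \<in> step v0. B w' x = c} = step v0" using all step_common by auto
      ultimately have "CARD('a) + 1 \<le> 2" using step_card[OF v0] by simp
      thus False using card_mono[of "UNIV :: 'a set" "{0, 1}"] by simp
    qed
    then obtain v where v: "v \<in> common" "B w' v \<noteq> c" by blast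
    define t where "t = c / (c - B w' v)"
    define v' where "v' = u + t *s (v - u)"
    have "v' \<in> aff" using v by (simp add: v'_def aff_line_point)
    moreover have "B u v' = 0" "B v v' = 0" using v by (simp_all add: v'_def)
    moreover have "B w' u = c" using True B_sym by metis
    moreover have "c - B w' v \<noteq> 0" using v by simp
    hence "c + t * (B w' v - c) = 0" unfolding t_def by (simp add: field_simps)
    ultimately have "v' \<in> aff" "B u v' = 0" "B v v' = 0" "B w' v' = 0" by (simp_all add: v'_def)
    thus thesis using that[of v v'] v B_sym[of w' v'] by (auto simp: near_def)
  qed
qed

end

section \<open>From quadrangles and pentagons to coboundaries\<close>

context affine_quadric
begin

lemma common_neighbours_agree:
  assumes d: "triangle_additive d" and uw: "u \<in> aff" "w \<in> aff"
    and v: "v \<in> aff" "near u v" "near v w" and v': "v' \<in> aff" "near u v'" "near v' w"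
  shows "(d u v \<noteq> d v w) = (d u v' \<noteq> d v' w)"
proof (cases "near u w")
  case True
  show ?thesis
    using triangle_additiveD[OF d uw(1) v(1) uw(2)] triangle_additiveD[OF d uw(1) v'(1) uw(2)] True v v'
    by simp
next
  case False
  interpret far_pair Q p u w by unfold_locales (use uw False in auto)
  show ?thesis by (rule common_neighbours_agree[OF d v v'])
qed

lemma diameter_two:
  assumes "u \<in> aff" "w \<in> aff"
  obtains v where "v \<in> aff" "near u v" "near v w"
proof (cases "near u w")
  case True
  thus thesis using that[of u] assms by simp
next
  case False
  interpret far_pair Q p u w by unfold_locales (use assms False in auto)
  obtain v where "v \<in> common" using common_nonempty by blast
  thus thesis using that[of v] by (auto simp: near_def)
qed

lemma near_shortcut:
  assumes u: "u \<in> aff" and x: "x \<in> aff" and y: "y \<in> aff" and xy: "near x y"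
  obtains v v' where "v \<in> aff" "v' \<in> aff" "near u v" "near v x" "near u v'" "near v' y" "near v v'"
proof (cases "near u x \<or> near u y")
  case True
  thus thesis using that[of u x] that[of y u] assms near_sym by auto
next
  case False
  then interpret far_pair Q p u x by unfold_locales (use u x in auto)
  define y' where "y' = (if B x y = 0 then y else p - y)"
  have "y' \<in> aff" "\<not> near u y'" "B x y' = 0"
    using False xy u x y by (auto simp: y'_def near_def)
  then obtain v v' where v: "v \<in> aff" "v' \<in> aff" "near u v" "near v x" "near u v'" "near v' y'" "near v v'"
    by (rule shortcut)
  moreover have "near v' y" using v y by (auto simp: y'_def split: if_splits)
  ultimately show thesis using that by blast
qed

text \<open>The collinearity graph of the ovoid geometry is simply connected modulo two, once its
  triangles are filled.\<close>

theorem triangle_additive_coboundary: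
  assumes d: "triangle_additive d"
  shows "\<exists>eps :: 'a ^ 6 \<Rightarrow> bool. \<forall>x \<in> aff. \<forall>y \<in> aff. near x y \<longrightarrow> d x y = (eps x \<noteq> eps y)"
proof (cases "aff = {}")
  case False
  then obtain u where u: "u \<in> aff" by blast
  \<comment> \<open>The value of \<open>d\<close> along a path of length two from the base point;
    the middle vertex does not matter because quadrangles are trivial.\<close>
  define eps where "eps x = (\<exists>v \<in> aff. near u v \<and> near v x \<and> (d u v \<noteq> d v x))" for x
  have eps: "eps x = (d u v \<noteq> d v x)" if "x \<in> aff" "v \<in> aff" "near u v" "near v x" for x v
    unfolding eps_def using common_neighbours_agree[OF d u that(1)] that by blast
  have "d x y = (eps x \<noteq> eps y)" if x: "x \<in> aff" and y: "y \<in> aff" and xy: "near x y" for x y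
  proof -
    obtain v v' where v: "v \<in> aff" "v' \<in> aff" "near u v" "near v x" "near u v'" "near v' y" "near v v'"
      using near_shortcut[OF u x y xy] .
    have 1: "d u v' = (d u v \<noteq> d v v')" using triangle_additiveD[OF d u v(1,2)] v by simp
    have 2: "(d x v \<noteq> d v v') = (d x y \<noteq> d y v')"
      using common_neighbours_agree[OF d x v(2) v(1) _ v(7) y xy] v near_sym by blast
    have sym: "d a b = d b a" if "a \<in> aff" "b \<in> aff" "near a b" for a b
      using triangle_additiveD[OF d that(1) that(2) that(1)] triangle_additiveD[OF d that(1) that(1) that(1)]
        that near_sym by auto
    have "d x v = d v x" "d y v' = d v' y" using sym v x y near_sym by blast+
    thus ?thesis using eps[OF x v(1,3,4)] eps[OF y v(2,5,6)] 1 2 by auto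
  qed
  hence *: "\<forall>x \<in> aff. \<forall>y \<in> aff. near x y \<longrightarrow> d x y = (eps x \<noteq> eps y)" by blast
  show ?thesis by (rule exI[of _ eps]) (rule *)
qed auto

end

section \<open>Lifting a cover\<close>

text \<open>\<open>over a e\<close> abstracts a cover: it says that the point represented by \<open>a\<close> is mapped to the
  ovoid subtended by \<open>e\<close>.\<close>

locale affine_cover = affine_quadric Q p
  for Q :: "'a::{field,finite} ^ 6 \<Rightarrow> 'a" and p +
  fixes over :: "'a ^ 6 \<Rightarrow> 'a ^ 6 \<Rightarrow> bool"
  assumes over_aff: "over a e \<Longrightarrow> a \<in> aff" "over a e \<Longrightarrow> e \<in> aff"
    and over_total: "a \<in> aff \<Longrightarrow> \<exists>e. over a e"
    and over_twin: "over a e \<Longrightarrow> over a e' \<longleftrightarrow> e' = e \<or> e' = p - e"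
    and over_near: "over a e \<Longrightarrow> over a' e' \<Longrightarrow> B a a' = 0 \<Longrightarrow> near e e'"
    and over_lift: "over a e \<Longrightarrow> e' \<in> aff \<Longrightarrow> near e e' \<Longrightarrow> \<exists>a'. over a' e' \<and> B a a' = 0"
    and over_unique: "over a e \<Longrightarrow> over a' e' \<Longrightarrow> over b' e' \<Longrightarrow> B a a' = 0 \<Longrightarrow> B a b' = 0 \<Longrightarrow> a' = b'"
    and over_line: "over a e \<Longrightarrow> over a' e' \<Longrightarrow> over a'' e'' \<Longrightarrow> B a a' = 0 \<Longrightarrow> B a' a'' = 0 \<Longrightarrow>
      B e e' = 0 \<Longrightarrow> B e' e'' = 0 \<Longrightarrow> B a a'' = 0 \<longleftrightarrow> B e e'' = 0"
begin

lemma twin_neq: "e \<in> aff \<Longrightarrow> p - e \<noteq> e"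
proof
  assume "e \<in> aff" "p - e = e"
  hence "B e (p - e) = B e e" by simp
  thus False using Qp \<open>e \<in> aff\<close> by simp
qed

definition fibre where "fibre e = {a. over a e}"

text \<open>A lift over \<open>e'\<close> is collinear with at most one lift over \<open>e\<close>,
  so distinct lifts over \<open>e\<close> have distinct collinear lifts over
  \<open>e'\<close>.\<close>

lemma fibre_card_mono:
  assumes "e \<in> aff" "e' \<in> aff" "near e e'"
  shows "card (fibre e) \<le> card (fibre e')"
proof -
  define f where "f a = (SOME a'. over a' e' \<and> B a a' = 0)" for a
  have f: "over (f a) e'" "B a (f a) = 0" if "a \<in> fibre e" for a
    using someI_ex[OF over_lift[of a e e']] that assms by (auto simp: f_def fibre_def)
  have "inj_on f (fibre e)"
  proof (rule inj_onI)
    fix a b assume ab: "a \<in> fibre e" "b \<in> fibre e" "f a = f b"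
    have "B (f a) a = 0" "B (f a) b = 0" using f[OF ab(1)] f[OF ab(2)] ab(3) B_sym by metis+
    thus "a = b" using over_unique[of "f a" e' a e b] f(1)[OF ab(1)] ab by (simp add: fibre_def)
  qed
  thus ?thesis using f(1) by (intro card_inj_on_le[of f]) (auto simp: fibre_def)
qed

text \<open>Fibres have constant size because near vectors have fibres of equal size and the
  diameter is two. Counting the pairs \<open>over a x\<close> both ways gives the size, as each
  \<open>a\<close> is over exactly one pair of twins.\<close>

lemma fibre_card:
  assumes "e \<in> aff"
  shows "card (fibre e) = 2"
proof -
  have eq1: "card (fibre x) = card (fibre y)" if "x \<in> aff" "y \<in> aff" "near x y" for x y
    using fibre_card_mono that near_sym by (simp add: order_antisym)
  have eq: "card (fibre x) = card (fibre e)" if "x \<in> aff" for x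
    using diameter_two[OF assms that] eq1 assms that by metis
  have "(\<Sum>x \<in> aff. card (fibre x)) = (\<Sum>x \<in> aff. \<Sum>a \<in> aff. if over a x then 1 else 0)"
  proof (rule sum.cong[OF refl])
    fix x
    have "{a \<in> aff. over a x} = fibre x" using over_aff by (auto simp: fibre_def)
    thus "card (fibre x) = (\<Sum>a \<in> aff. if over a x then 1 else 0)"
      by (simp add: sum.If_cases Int_def)
  qed
  also have "\<dots> = (\<Sum>a \<in> aff. \<Sum>x \<in> aff. if over a x then 1 else 0)" by (rule sum.swap)
  also have "\<dots> = (\<Sum>a \<in> aff. 2)"
  proof (rule sum.cong[OF refl])
    fix a assume "a \<in> aff"
    then obtain x where x: "over a x" using over_total by blast
    hence "{y \<in> aff. over a y} = {x, p - x}" using over_aff(2)[of a] over_twin[OF x] by blast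
    hence "card {y \<in> aff. over a y} = 2" using twin_neq[OF over_aff(2)[OF x]] by (metis card_2_iff)
    thus "(\<Sum>y \<in> aff. if over a y then 1 else 0) = (2 :: nat)"
      by (simp add: sum.If_cases Int_def)
  qed
  finally have "card aff * card (fibre e) = card aff * 2" using eq by simp
  moreover have "card aff \<noteq> 0" using assms by auto
  ultimately show ?thesis by simp
qed

lemma fibre_other:
  assumes "over a e"
  obtains b where "over b e" "b \<noteq> a" "\<And>x. over x e \<longleftrightarrow> x = a \<or> x = b"
proof -
  obtain x y where xy: "fibre e = {x, y}" "x \<noteq> y"
    using fibre_card[OF over_aff(2)[OF assms]] by (meson card_2_iff)
  have o: "over z e \<longleftrightarrow> z = x \<or> z = y" for z using xy(1) by (auto simp: fibre_def)
  define b where "b = (if a = x then y else x)"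
  have "over b e" "b \<noteq> a" using o xy(2) assms by (auto simp: b_def)
  moreover have "over z e \<longleftrightarrow> z = a \<or> z = b" for z using o[of z] o[of a] assms by (auto simp: b_def)
  ultimately show thesis by (rule that)
qed

text \<open>At least one of the two lifts is collinear with \<open>a'\<close> by
  \<open>over_lift\<close>, at most one by \<open>over_unique\<close>. Thus exchanging the sheets
  over \<open>e\<close> negates collinearity.\<close>

lemma fibre_flip:
  assumes "over a e" "over b e" "a \<noteq> b" "over a' e'" "near e e'"
  shows "(B a a' = 0) = (B b a' \<noteq> 0)"
proof -
  obtain c where c: "\<And>x. over x e \<longleftrightarrow> x = a \<or> x = c" using fibre_other[OF assms(1)] by metis
  obtain x where x: "over x e" "B a' x = 0"
    using over_lift[OF assms(4) over_aff(2)[OF assms(1)]] assms(5) near_sym by blast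
  have "x = a \<or> x = b" using c assms x by metis
  moreover have "\<not> (B a a' = 0 \<and> B b a' = 0)"
    using over_unique[OF assms(4,1,2)] assms(3) B_sym by metis
  ultimately show ?thesis using x(2) B_sym by metis
qed

text \<open>The same exchange rule for the natural projection, whose fibres are the pairs of
  twins.\<close>

lemma twin_flip:
  assumes "x \<in> aff" "y \<in> aff" "near x y"
  shows "(B (p - x) y = 0) = (B x y \<noteq> 0)"
proof -
  have "(t - b = 0) = (b \<noteq> 0)" if "b = 0 \<or> b = t" "t \<noteq> 0" for b t :: 'a
    using that by auto
  from this[OF assms(3)[unfolded near_def] Qp] show ?thesis
    by (simp only: B_twin(1)[OF assms(1,2)])
qed

text \<open>Where necessary, \<open>e1\<close>, \<open>e3\<close> are replaced by their twins and
  \<open>a1\<close>, \<open>a3\<close> by the other lifts, so that all edges at the second vertex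
  become collinear; then \<open>over_line\<close> compares the third edges above and below. Each
  exchange negates the edges it touches, so undoing the exchanges yields the parity
  relation.\<close>

lemma lifts_triangle:
  assumes o: "over a1 e1" "over a2 e2" "over a3 e3" and n: "near e1 e2" "near e2 e3" "near e1 e3"
  shows "((B e1 e3 = 0) = (B a1 a3 = 0)) =
    (((B e1 e2 = 0) = (B a1 a2 = 0)) = ((B e2 e3 = 0) = (B a2 a3 = 0)))"
proof -
  note aff = over_aff(2)[OF o(1)] over_aff(2)[OF o(2)] over_aff(2)[OF o(3)]
  have normal: "\<exists>e' a'. over a' e \<and> over a' e' \<and> B e' e2 = 0 \<and> B a' a2 = 0 \<and> (e' = e \<or> e' = p - e) \<and>
      (B e e2 = 0) = (e = e') \<and> (B a a2 = 0) = (a = a')"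
    if ae: "over a e" and near: "near e e2" for a e
  proof -
    have e: "e \<in> aff" using over_aff ae by blast
    define e' where "e' = (if B e e2 = 0 then e else p - e)"
    have e': "B e' e2 = 0" "e' = e \<or> e' = p - e" "(B e e2 = 0) = (e = e')"
      using near twin_neq[OF e] e aff by (auto simp: e'_def near_def)
    obtain a' where a': "over a' e" "B a2 a' = 0"
      using over_lift[OF o(2) e] near near_sym by blast
    have "(B a a2 = 0) = (a = a')"
      using over_unique[OF o(2) ae a'(1)] a'(2) B_sym by metis
    moreover have "over a' e'" using over_twin[OF a'(1)] e'(2) by simp
    ultimately show ?thesis using e' a' B_sym by metis
  qed
  obtain e1' a1' where 1: "over a1' e1" "over a1' e1'" "B e1' e2 = 0" "B a1' a2 = 0"
      "e1' = e1 \<or> e1' = p - e1" "(B e1 e2 = 0) = (e1 = e1')" "(B a1 a2 = 0) = (a1 = a1')"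
    using normal[OF o(1) n(1)] by blast
  obtain e3' a3' where 3: "over a3' e3" "over a3' e3'" "B e3' e2 = 0" "B a3' a2 = 0"
      "e3' = e3 \<or> e3' = p - e3" "(B e3 e2 = 0) = (e3 = e3')" "(B a3 a2 = 0) = (a3 = a3')"
    using normal[OF o(3)] n(2) near_sym by metis
  have line: "B a1' a3' = 0 \<longleftrightarrow> B e1' e3' = 0"
    using over_line[OF 1(2) o(2) 3(2) 1(4) _ 1(3)] 3 B_sym by metis
  have n3: "near e1' e3" using n(3) 1(5) aff by auto
  have a: "(B a1 a3 = 0) = ((B a1' a3' = 0) = ((a1 = a1') = (a3 = a3')))"
  proof -
    have "(B a1 a3 = 0) = ((B a1' a3 = 0) = (a1 = a1'))"
      using fibre_flip[OF o(1) 1(1) _ o(3) n(3)] by auto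
    moreover have "(B a3 a1' = 0) = ((B a3' a1' = 0) = (a3 = a3'))"
      using fibre_flip[OF o(3) 3(1) _ 1(1)] n(3) near_sym by auto
    ultimately show ?thesis using B_sym by metis
  qed
  have e: "(B e1 e3 = 0) = ((B e1' e3' = 0) = ((e1 = e1') = (e3 = e3')))"
  proof -
    have "(B e1 e3 = 0) = ((B e1' e3 = 0) = (e1 = e1'))"
      using 1(5) twin_flip[OF aff(1,3) n(3)] twin_neq[OF aff(1)] by metis
    moreover have "(B e3 e1' = 0) = ((B e3' e1' = 0) = (e3 = e3'))"
      using 3(5) twin_flip[OF aff(3) over_aff(2)[OF 1(2)]] n3 near_sym twin_neq[OF aff(3)] by metis
    ultimately show ?thesis using B_sym by metis
  qed
  have "(B e2 e3 = 0) = (e3 = e3')" "(B a2 a3 = 0) = (a3 = a3')"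
    using 3(6,7) B_sym by metis+
  thus ?thesis using a e line 1(6,7) by blast
qed

text \<open>The cochain \<open>d\<close> measures how far an arbitrary section \<open>h\<close> of
  the cover is from preserving collinearity. Being a coboundary, it is removed by exchanging sheets
  wherever \<open>eps\<close> holds; the inverse of the corrected section is the required
  map.\<close>

theorem cover_factorization:
  "\<exists>\<alpha>. bij_betw \<alpha> aff aff \<and> (\<forall>a \<in> aff. over a (\<alpha> a)) \<and>
     (\<forall>a \<in> aff. \<forall>b \<in> aff. B (\<alpha> a) (\<alpha> b) = 0 \<longleftrightarrow> B a b = 0)"
proof -
  define h where "h e = (SOME a. over a e)" for e
  have h: "over (h e) e" if "e \<in> aff" for e
  proof -
    have "fibre e \<noteq> {}" using fibre_card[OF that] by auto
    thus ?thesis unfolding h_def fibre_def by (auto intro: someI)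
  qed
  define d where "d e e' \<longleftrightarrow> (B e e' = 0) \<noteq> (B (h e) (h e') = 0)" for e e'
  have "triangle_additive d"
    unfolding triangle_additive_def
  proof (intro ballI impI)
    fix x y z assume "x \<in> aff" "y \<in> aff" "z \<in> aff" "near x y" "near y z" "near x z"
    thus "d x z = (d x y \<noteq> d y z)"
      using lifts_triangle[OF h h h, of x y z] unfolding d_def by blast
  qed
  from triangle_additive_coboundary[OF this] obtain eps :: "'a ^ 6 \<Rightarrow> bool"
    where eps: "\<forall>x \<in> aff. \<forall>y \<in> aff. near x y \<longrightarrow> d x y = (eps x \<noteq> eps y)" ..
  define other where "other e = (SOME b. over b e \<and> b \<noteq> h e)" for e
  have other: "over (other e) e" "other e \<noteq> h e" if e: "e \<in> aff" for e
  proof -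
    obtain b where "over b e" "b \<noteq> h e" using fibre_other[OF h[OF e]] by metis
    hence "\<exists>b. over b e \<and> b \<noteq> h e" by blast
    from someI_ex[OF this] show "over (other e) e" "other e \<noteq> h e" by (auto simp: other_def)
  qed
  define \<beta> where "\<beta> e = (if eps e then other e else h e)" for e
  have over_\<beta>: "over (\<beta> e) e" if "e \<in> aff" for e using h other that by (simp add: \<beta>_def)
  have near_\<beta>: "(B (\<beta> x) (\<beta> y) = 0) = (B x y = 0)" if x: "x \<in> aff" and y: "y \<in> aff" and n: "near x y" for x y
  proof -
    have 1: "(B (\<beta> x) (h y) = 0) = ((B (h x) (h y) = 0) \<noteq> eps x)"
      using fibre_flip[OF h[OF x] other(1)[OF x] _ h[OF y] n] other(2)[OF x] by (auto simp: \<beta>_def)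
    have "(B (\<beta> y) (\<beta> x) = 0) = ((B (h y) (\<beta> x) = 0) \<noteq> eps y)"
      using fibre_flip[OF h[OF y] other(1)[OF y] _ over_\<beta>[OF x]] n near_sym other(2)[OF y]
      by (auto simp: \<beta>_def)
    hence 2: "(B (\<beta> x) (\<beta> y) = 0) = ((B (\<beta> x) (h y) = 0) \<noteq> eps y)" using B_sym by metis
    have "((B x y = 0) \<noteq> (B (h x) (h y) = 0)) = (eps x \<noteq> eps y)" using eps x y n by (simp add: d_def)
    thus ?thesis using 1 2 by blast
  qed
  \<comment> \<open>If \<open>x\<close> and \<open>y\<close> are not near, both sides are false:
    collinear images would make them near by \<open>over_near\<close>.\<close>
  have coll: "(B (\<beta> x) (\<beta> y) = 0) = (B x y = 0)" if "x \<in> aff" "y \<in> aff" for x y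
    using near_\<beta>[OF that] over_near[OF over_\<beta> over_\<beta>, of x y] that by (auto simp: near_def)
  have inj: "inj_on \<beta> aff"
  proof (rule inj_onI)
    fix x y assume xy: "x \<in> aff" "y \<in> aff" "\<beta> x = \<beta> y"
    have "over (\<beta> x) y" using over_\<beta>[OF xy(2)] xy(3) by simp
    hence "y = x \<or> y = p - x" using over_twin[OF over_\<beta>[OF xy(1)]] by simp
    \<comment> \<open>This excludes \<open>y = p - x\<close>, for which
      \<open>B x y = s\<close>.\<close>
    moreover have "B x y = 0" using coll[OF xy(1,2)] xy(3) over_aff(1)[OF over_\<beta>[OF xy(2)]] by simp
    ultimately show "x = y" using xy(1) Qp by auto
  qed
  have im: "\<beta> ` aff = aff"
    using over_aff(1)[OF over_\<beta>] inj by (intro endo_inj_surj) auto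
  have bij: "bij_betw \<beta> aff aff" using inj im by (simp add: bij_betw_def)
  define \<alpha> where "\<alpha> = inv_into aff \<beta>"
  have \<alpha>: "\<alpha> a \<in> aff" "\<beta> (\<alpha> a) = a" if "a \<in> aff" for a
    using that im inv_into_into[of a \<beta> aff] f_inv_into_f[of a \<beta> aff] by (auto simp: \<alpha>_def)
  have "bij_betw \<alpha> aff aff" unfolding \<alpha>_def by (rule bij_betw_inv_into[OF bij])
  moreover have "over a (\<alpha> a)" if "a \<in> aff" for a using over_\<beta>[OF \<alpha>(1)[OF that]] \<alpha>(2)[OF that] by simp
  moreover have "B (\<alpha> a) (\<alpha> b) = 0 \<longleftrightarrow> B a b = 0" if "a \<in> aff" "b \<in> aff" for a b
    using coll[OF \<alpha>(1)[OF that(1)] \<alpha>(1)[OF that(2)]] \<alpha>(2) that by simp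
  ultimately show ?thesis by blast
qed

end

section \<open>Extension to infinity\<close>

lemma span_singleton_eq_iff:
  fixes v w :: "'a::field ^ 'n"
  assumes "v \<noteq> 0" "w \<noteq> 0"
  shows "vec.span {v} = vec.span {w} \<longleftrightarrow> (\<exists>r. r \<noteq> 0 \<and> w = r *s v)"
proof
  assume "vec.span {v} = vec.span {w}"
  hence "w \<in> vec.span {v}" using vec.span_base by blast
  then obtain r where "w = r *s v" by (rule in_span1E)
  thus "\<exists>r. r \<noteq> 0 \<and> w = r *s v" using assms by auto
next
  assume "\<exists>r. r \<noteq> 0 \<and> w = r *s v"
  then obtain r where r: "r \<noteq> 0" "w = r *s v" by blast
  have "v = (1 / r) *s w" using r by simp
  hence "v \<in> vec.span {w}" unfolding vec.span_singleton by blast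
  moreover have "w \<in> vec.span {v}" using r unfolding vec.span_singleton by blast
  ultimately show "vec.span {v} = vec.span {w}"
    by (intro equalityI vec.span_minimal) auto
qed

context affine_quadric
begin

text \<open>Unlike \<open>aff\<close> this set is not normalized: a point of the hyperplane section
  has q - 1 representatives, so equality of points is expressed through spans.\<close>

definition infinity :: "('a ^ 6) set" where
  "infinity = {d. Q d = 0 \<and> B p d = 0 \<and> d \<noteq> 0}"

lemma infinityI: "Q d = 0 \<Longrightarrow> B p d = 0 \<Longrightarrow> d \<noteq> 0 \<Longrightarrow> d \<in> infinity"
  unfolding infinity_def by blast

lemma infinityD:
  assumes "d \<in> infinity"
  shows "Q d = 0" "B p d = 0" "B d p = 0" "B d d = 0" "d \<noteq> 0"
  using assms B_self[of d] B_sym[of d p] by (simp_all add: infinity_def)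

lemma infinity_affine_neighbour:
  assumes "d \<in> infinity"
  obtains a where "a \<in> aff" "B a d = 0"
proof -
  obtain y where y: "Q y = 0" "B d y = 0" "y \<notin> vec.span {d}"
    using singular_neighbour infinityD[OF assms] by metis
  have "p \<notin> vec.span {d}"
  proof
    assume "p \<in> vec.span {d}"
    then obtain t where "p = t *s d" by (rule in_span1E)
    hence "Q p = t\<^sup>2 * Q d" using Q_scale by metis
    thus False using Qp infinityD[OF assms] by simp
  qed
  moreover have "y \<in> perp_space {d}" using y by (simp add: perp_space_def)
  ultimately obtain x where x: "x \<in> perp_space {d}" "Q x = 0" "B p x \<noteq> 0"
    using singular_perp_exists y by blast
  have "(s / B p x) *s x \<in> aff" using x by (intro affI) auto
  moreover have "B ((s / B p x) *s x) d = 0" using x B_sym[of x d] by (simp add: perp_space_def)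
  ultimately show thesis by (rule that)
qed

text \<open>For \<open>d\<close> in \<open>infinity\<close> orthogonal to \<open>a\<close> these are
  the affine points of the line joining \<open>a\<close> to the point of \<open>d\<close>.\<close>

definition ray :: "'a ^ 6 \<Rightarrow> 'a ^ 6 \<Rightarrow> ('a ^ 6) set" where
  "ray a d = range (\<lambda>t. a + t *s d)"

lemma ray_aff:
  assumes "a \<in> aff" "d \<in> infinity" "B a d = 0" "x \<in> ray a d"
  shows "x \<in> aff" "B a x = 0" "B x d = 0"
  using assms infinityD[OF assms(2)] by (auto simp: ray_def Q_add intro!: affI)

lemma ray_self: "a \<in> ray a d"
  unfolding ray_def by (rule range_eqI[of _ _ 0]) simp

lemma ray_end: "a + d \<in> ray a d"
  unfolding ray_def by (rule range_eqI[of _ _ 1]) simp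

lemma ray_shift:
  assumes "x \<in> ray a d"
  shows "ray x d = ray a d"
proof -
  obtain t where t: "x = a + t *s d" using assms by (auto simp: ray_def)
  have "a + u *s d = x + (u - t) *s d" for u by (simp add: t vec.scale_left_diff_distrib)
  hence "a + u *s d \<in> ray x d" for u unfolding ray_def by blast
  moreover have "x + u *s d = a + (t + u) *s d" for u by (simp add: t vec.scale_left_distrib)
  hence "x + u *s d \<in> ray a d" for u unfolding ray_def by blast
  ultimately show ?thesis unfolding ray_def by blast
qed

lemma ray_scale:
  assumes "r \<noteq> 0"
  shows "ray a (r *s d) = ray a d"
proof -
  have "a + u *s d = a + (u / r) *s (r *s d)" for u using assms by simp
  hence "a + u *s d \<in> ray a (r *s d)" for u unfolding ray_def by blast
  moreover have "a + u *s (r *s d) = a + (u * r) *s d" for u by simp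
  hence "a + u *s (r *s d) \<in> ray a d" for u unfolding ray_def by blast
  ultimately show ?thesis unfolding ray_def by blast
qed

lemma ray_card:
  assumes "d \<noteq> 0"
  shows "card (ray a d) = CARD('a)"
  unfolding ray_def using assms by (intro card_image) (auto simp: inj_on_def)

lemma ray_unique:
  assumes "a \<in> aff" "b \<in> aff" "x \<in> aff" "B a b = 0" "B a x = 0" "B b x = 0" "a \<noteq> b"
  shows "x \<in> ray a (b - a)"
  using aff_no_triangle[OF assms] by (auto simp: ray_def)

lemma difference_infinity:
  assumes "a \<in> aff" "b \<in> aff" "B a b = 0" "a \<noteq> b"
  shows "b - a \<in> infinity" "B a (b - a) = 0"
  using assms B_sym[of b a] by (auto intro!: infinityI simp: Q_diff)

text \<open>Lines of the affine quadrangle meeting at infinity are recognized inside it: they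
  coincide or have no transversal.\<close>

lemma parallel_iff:
  assumes d: "d \<in> infinity" "a \<in> aff" "B a d = 0" and d': "d' \<in> infinity" "a' \<in> aff" "B a' d' = 0"
  shows "vec.span {d} = vec.span {d'} \<longleftrightarrow>
    ray a d = ray a' d' \<or> (\<forall>x \<in> ray a d. \<forall>y \<in> ray a' d'. B x y \<noteq> 0)"
proof
  assume "vec.span {d} = vec.span {d'}"
  then obtain r where r: "r \<noteq> 0" "d' = r *s d"
    using span_singleton_eq_iff infinityD(5)[OF d(1)] infinityD(5)[OF d'(1)] by blast
  have rd': "ray a' d' = ray a' d" using r ray_scale by simp
  have "ray a d = ray a' d'" if x: "x \<in> ray a d" and y: "y \<in> ray a' d'" and xy: "B x y = 0" for x y
  proof -
    have xa: "x \<in> aff" "B x d = 0" using ray_aff[OF d(2,1,3) x] by auto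
    have ya: "y \<in> aff" "B y d = 0" using ray_aff[OF d'(2,1,3) y] r by auto
    have "x + d \<in> aff" "B x (x + d) = 0" "B (x + d) y = 0"
      using ray_aff[OF xa(1) d(1) xa(2) ray_end] xy ya B_sym[of d y] by auto
    hence "y \<in> ray x (x + d - x)"
      using xa ya xy infinityD(5)[OF d(1)] by (intro ray_unique) auto
    hence "ray y d = ray x d" using ray_shift by simp
    thus ?thesis using ray_shift[OF x] ray_shift[of y a' d] y rd' by simp
  qed
  thus "ray a d = ray a' d' \<or> (\<forall>x \<in> ray a d. \<forall>y \<in> ray a' d'. B x y \<noteq> 0)" by blast
next
  assume "ray a d = ray a' d' \<or> (\<forall>x \<in> ray a d. \<forall>y \<in> ray a' d'. B x y \<noteq> 0)"
  hence "\<exists>r. d' = r *s d"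
  proof
    assume eq: "ray a d = ray a' d'"
    have "a' \<in> ray a d" "a' + d' \<in> ray a d" using eq ray_self ray_end by auto
    then obtain t u where "a' = a + t *s d" "a' + d' = a + u *s d" unfolding ray_def by blast
    hence "d' = (u - t) *s d" by (simp add: vec.scale_left_diff_distrib algebra_simps)
    thus ?thesis by blast
  next
    assume none: "\<forall>x \<in> ray a d. \<forall>y \<in> ray a' d'. B x y \<noteq> 0"
    have z: "B x d' = 0" if x: "x \<in> ray a d" for x
    proof (rule ccontr)
      assume n: "B x d' \<noteq> 0"
      let ?y = "a' + (- B x a' / B x d') *s d'"
      have "?y \<in> ray a' d'" unfolding ray_def by blast
      moreover have "B x ?y = 0" using n by simp
      ultimately show False using none x by blast
    qed
    have ad': "B a d' = 0" "B d d' = 0" using z[OF ray_self] z[OF ray_end] by auto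
    have "a + d \<in> aff" using ray_aff(1)[OF d(2,1,3) ray_end] .
    moreover have "a + d' \<in> aff" using ray_aff(1)[OF d(2) d'(1) ad'(1) ray_end] .
    moreover have "B (a + d) (a + d') = 0" using d ad' B_sym[of d a] by simp
    ultimately have "a + d' \<in> ray a (a + d - a)"
      using d ad' infinityD(5)[OF d(1)] by (intro ray_unique) auto
    thus ?thesis by (auto simp: ray_def)
  qed
  then obtain r where r: "d' = r *s d" by blast
  moreover have "r \<noteq> 0" using r infinityD(5)[OF d'(1)] by auto
  ultimately show "vec.span {d} = vec.span {d'}"
    using span_singleton_eq_iff infinityD(5)[OF d(1)] infinityD(5)[OF d'(1)] by blast
qed

text \<open>If \<open>d\<close> and \<open>d'\<close> were orthogonal, then \<open>a\<close>,
  \<open>a + d\<close>, \<open>a + d'\<close> would form a triangle; if they are not, the line from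
  some \<open>a\<close> towards \<open>d\<close> has a vector orthogonal to \<open>d'\<close>. So
  collinearity at infinity can be read off from affine points.\<close>

lemma infinity_noncollinear_iff:
  assumes d: "d \<in> infinity" "d' \<in> infinity" and neq: "vec.span {d} \<noteq> vec.span {d'}"
  shows "B d d' \<noteq> 0 \<longleftrightarrow> (\<exists>a \<in> aff. B a d = 0 \<and> B a d' = 0)"
proof
  assume n: "B d d' \<noteq> 0"
  obtain a where a: "a \<in> aff" "B a d = 0" using infinity_affine_neighbour[OF d(1)] .
  let ?x = "a + (- B a d' / B d d') *s d"
  have "?x \<in> ray a d" unfolding ray_def by blast
  hence "?x \<in> aff" "B ?x d = 0" by (rule ray_aff[OF a(1) d(1) a(2)])+
  moreover have "B ?x d' = 0" using n by simp
  ultimately show "\<exists>a \<in> aff. B a d = 0 \<and> B a d' = 0" by blast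
next
  assume "\<exists>a \<in> aff. B a d = 0 \<and> B a d' = 0"
  then obtain a where a: "a \<in> aff" "B a d = 0" "B a d' = 0" by blast
  show "B d d' \<noteq> 0"
  proof
    assume z: "B d d' = 0"
    have "a + d \<in> aff" "a + d' \<in> aff" using ray_aff(1) ray_end a d by blast+
    moreover have "B (a + d) (a + d') = 0" using a z B_sym[of d a] by simp
    ultimately have "a + d' \<in> ray a (a + d - a)"
      using a infinityD(5)[OF d(1)] by (intro ray_unique) auto
    then obtain r where "a + d' = a + r *s (a + d - a)" unfolding ray_def by blast
    hence "d' = r *s d" by simp
    thus False using neq span_singleton_eq_iff infinityD(5)[OF d(1)] infinityD(5)[OF d(2)]
      by (metis vec.scale_zero_left)
  qed
qed

end

section \<open>Extending an automorphism of the affine part to the points at infinity\<close>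

locale affine_automorphism = affine_quadric Q p
  for Q :: "'a::{field,finite} ^ 6 \<Rightarrow> 'a" and p +
  fixes \<alpha> :: "'a ^ 6 \<Rightarrow> 'a ^ 6"
  assumes bij: "bij_betw \<alpha> aff aff"
    and coll: "a \<in> aff \<Longrightarrow> b \<in> aff \<Longrightarrow> B (\<alpha> a) (\<alpha> b) = 0 \<longleftrightarrow> B a b = 0"
begin

lemma \<alpha>_aff: "a \<in> aff \<Longrightarrow> \<alpha> a \<in> aff"
  using bij by (auto simp: bij_betw_def)

lemma \<alpha>_eq_iff: "a \<in> aff \<Longrightarrow> b \<in> aff \<Longrightarrow> \<alpha> a = \<alpha> b \<longleftrightarrow> a = b"
  using bij by (auto simp: bij_betw_def inj_on_def)

lemma \<alpha>_surj: assumes "b \<in> aff" obtains a where "a \<in> aff" "\<alpha> a = b"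
  using bij assms unfolding bij_betw_def by (metis imageE)

text \<open>The map \<open>\<alpha>\<close> is not known to be linear, so the vector may depend on
  \<open>a\<close>; by \<open>dir_parallel\<close> its span does not.\<close>

definition dir :: "'a ^ 6 \<Rightarrow> 'a ^ 6 \<Rightarrow> 'a ^ 6" where
  "dir a d = \<alpha> (a + d) - \<alpha> a"

lemma dir_infinity:
  assumes "a \<in> aff" "d \<in> infinity" "B a d = 0"
  shows "dir a d \<in> infinity" "B (\<alpha> a) (dir a d) = 0"
proof -
  have "a + d \<in> aff" "B a (a + d) = 0" "a + d \<noteq> a"
    using ray_aff[OF assms ray_end] infinityD(5)[OF assms(2)] by auto
  thus "dir a d \<in> infinity" "B (\<alpha> a) (dir a d) = 0"
    using difference_infinity[of "\<alpha> a" "\<alpha> (a + d)"] assms(1) coll \<alpha>_aff \<alpha>_eq_iff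
    by (auto simp: dir_def simp del: B_diff)
qed

lemma \<alpha>_ray:
  assumes "a \<in> aff" "d \<in> infinity" "B a d = 0"
  shows "\<alpha> ` ray a d = ray (\<alpha> a) (dir a d)"
proof (rule card_subset_eq)
  show "\<alpha> ` ray a d \<subseteq> ray (\<alpha> a) (dir a d)"
  proof (rule image_subsetI)
    fix x assume x: "x \<in> ray a d"
    note e = ray_aff[OF assms ray_end] ray_aff[OF assms x]
    have "B (a + d) x = 0" using e B_sym[of x d] by simp
    thus "\<alpha> x \<in> ray (\<alpha> a) (dir a d)"
      unfolding dir_def using e assms infinityD(5)[OF assms(2)]
      by (intro ray_unique) (auto simp: coll \<alpha>_aff \<alpha>_eq_iff simp del: B_add_left B_add_right)
  qed
  have "inj_on \<alpha> (ray a d)"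
    using bij ray_aff(1)[OF assms] by (auto simp: bij_betw_def intro: inj_on_subset)
  thus "card (\<alpha> ` ray a d) = card (ray (\<alpha> a) (dir a d))"
    using infinityD(5) assms(2) dir_infinity[OF assms] by (simp add: card_image ray_card)
qed simp

text \<open>By \<open>parallel_iff\<close> both sides are conditions on equality and collinearity of
  rays, which \<open>\<alpha>\<close> preserves.\<close>

lemma dir_parallel:
  assumes d: "a \<in> aff" "d \<in> infinity" "B a d = 0" and d': "a' \<in> aff" "d' \<in> infinity" "B a' d' = 0"
  shows "vec.span {dir a d} = vec.span {dir a' d'} \<longleftrightarrow> vec.span {d} = vec.span {d'}"
proof -
  have sub: "ray a d \<subseteq> aff" "ray a' d' \<subseteq> aff" using ray_aff(1) d d' by auto
  have "\<alpha> ` ray a d = \<alpha> ` ray a' d' \<longleftrightarrow> ray a d = ray a' d'"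
    by (rule inj_on_image_eq_iff[OF bij_betw_imp_inj_on[OF bij] sub])
  moreover have "(\<forall>x \<in> \<alpha> ` ray a d. \<forall>y \<in> \<alpha> ` ray a' d'. B x y \<noteq> 0) \<longleftrightarrow>
      (\<forall>x \<in> ray a d. \<forall>y \<in> ray a' d'. B x y \<noteq> 0)"
    using coll sub by blast
  ultimately show ?thesis
    using parallel_iff[OF d(2,1,3) d'(2,1,3)]
      parallel_iff[OF dir_infinity(1)[OF d] \<alpha>_aff[OF d(1)] dir_infinity(2)[OF d]
        dir_infinity(1)[OF d'] \<alpha>_aff[OF d'(1)] dir_infinity(2)[OF d']]
    by (simp add: \<alpha>_ray[OF d] \<alpha>_ray[OF d'])
qed

definition centre :: "'a ^ 6 \<Rightarrow> 'a ^ 6" where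
  "centre d = (SOME a. a \<in> aff \<and> B a d = 0)"

text \<open>At infinity only the span of the value is canonical, as the scalar factor may vary with
  the choice of \<open>centre\<close>. Values outside \<open>aff\<close> and \<open>infinity\<close>
  are irrelevant.\<close>

definition ext :: "'a ^ 6 \<Rightarrow> 'a ^ 6" where
  "ext v = (if v \<in> aff then \<alpha> v else dir (centre v) v)"

lemma aff_not_infinity: "v \<in> aff \<Longrightarrow> v \<notin> infinity"
  using Qp affD(2) infinityD(2) by metis

lemma centre:
  assumes "d \<in> infinity"
  shows "centre d \<in> aff" "B (centre d) d = 0"
proof -
  have "\<exists>a. a \<in> aff \<and> B a d = 0" using infinity_affine_neighbour[OF assms] by metis
  from someI_ex[OF this] show "centre d \<in> aff" "B (centre d) d = 0" by (auto simp: centre_def)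
qed

lemma ext_infinity: "d \<in> infinity \<Longrightarrow> ext d = dir (centre d) d"
  using aff_not_infinity by (auto simp: ext_def)

lemma ext_aff: "a \<in> aff \<Longrightarrow> ext a = \<alpha> a"
  by (simp add: ext_def)

lemma ext_in_infinity: "d \<in> infinity \<Longrightarrow> ext d \<in> infinity"
  using ext_infinity dir_infinity centre by simp

lemma ext_span:
  assumes "a \<in> aff" "d \<in> infinity" "B a d = 0"
  shows "vec.span {ext d} = vec.span {dir a d}"
  using dir_parallel[OF centre(1)[OF assms(2)] assms(2) centre(2)[OF assms(2)] assms] assms
  by (simp add: ext_infinity)

lemma ext_infinity_eq_iff:
  assumes "d \<in> infinity" "d' \<in> infinity"
  shows "vec.span {ext d} = vec.span {ext d'} \<longleftrightarrow> vec.span {d} = vec.span {d'}"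
  using dir_parallel[OF centre(1)[OF assms(1)] assms(1) centre(2)[OF assms(1)]
      centre(1)[OF assms(2)] assms(2) centre(2)[OF assms(2)]] assms
  by (simp add: ext_infinity)

lemma B_span_zero:
  assumes "vec.span {v} = vec.span {w}" "B x v = 0"
  shows "B x w = 0"
proof -
  have "w \<in> vec.span {v}" using assms(1) vec.span_base by blast
  then obtain t where "w = t *s v" by (rule in_span1E)
  thus ?thesis using assms(2) by simp
qed

text \<open>For the direct implication, the affine vector \<open>\<alpha> a + ext d\<close> is
  \<open>\<alpha> b\<close> for some \<open>b\<close>. Then \<open>b - a\<close> and
  \<open>d\<close> have images with equal spans, hence equal spans themselves, and \<open>a\<close>
  is orthogonal to \<open>b - a\<close>.\<close>

lemma ext_mixed:
  assumes a: "a \<in> aff" and d: "d \<in> infinity"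
  shows "B (ext a) (ext d) = 0 \<longleftrightarrow> B a d = 0"
proof
  assume "B a d = 0"
  with ext_span[OF a d] dir_infinity(2)[OF a d] show "B (ext a) (ext d) = 0"
    using B_span_zero[of "dir a d" "ext d"] a by (simp add: ext_aff)
next
  assume z: "B (ext a) (ext d) = 0"
  have e: "ext d \<in> infinity" by (rule ext_in_infinity[OF d])
  have z': "B (\<alpha> a) (ext d) = 0" using z a by (simp add: ext_aff)
  note x = ray_aff[OF \<alpha>_aff[OF a] e z' ray_end]
  obtain b where b: "b \<in> aff" "\<alpha> b = \<alpha> a + ext d" using \<alpha>_surj[OF x(1)] .
  have "B a b = 0" using coll[OF a b(1)] x(2) b(2) by simp
  moreover have "a \<noteq> b" using b(2) infinityD(5)[OF e] by auto
  ultimately have ba: "b - a \<in> infinity" "B a (b - a) = 0" using difference_infinity a b by auto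
  have "dir a (b - a) = ext d" using b(2) by (simp add: dir_def)
  hence "vec.span {ext (b - a)} = vec.span {ext d}" using ext_span[OF a ba] by simp
  hence "vec.span {b - a} = vec.span {d}" using ext_infinity_eq_iff[OF ba(1) d] by simp
  thus "B a d = 0" using B_span_zero ba(2) by blast
qed

text \<open>Distinct points at infinity are orthogonal iff no affine vector is orthogonal to both, a
  condition transported by \<open>ext_mixed\<close> and the surjectivity of
  \<open>\<alpha>\<close>.\<close>

lemma ext_perp:
  assumes "v \<in> aff \<union> infinity" "w \<in> aff \<union> infinity"
  shows "B (ext v) (ext w) = 0 \<longleftrightarrow> B v w = 0"
proof -
  have inf: "B (ext d) (ext d') = 0 \<longleftrightarrow> B d d' = 0" if d: "d \<in> infinity" "d' \<in> infinity" for d d'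
  proof (cases "vec.span {d} = vec.span {d'}")
    case True
    hence "vec.span {ext d} = vec.span {ext d'}" using ext_infinity_eq_iff[OF d] by simp
    thus ?thesis using True B_span_zero infinityD(4) d ext_in_infinity by metis
  next
    case False
    have "vec.span {ext d} \<noteq> vec.span {ext d'}" using False ext_infinity_eq_iff[OF d] by simp
    from infinity_noncollinear_iff[OF ext_in_infinity[OF d(1)] ext_in_infinity[OF d(2)] this]
    have "B (ext d) (ext d') \<noteq> 0 \<longleftrightarrow> (\<exists>a \<in> aff. B a (ext d) = 0 \<and> B a (ext d') = 0)" .
    also have "\<dots> \<longleftrightarrow> (\<exists>a \<in> \<alpha> ` aff. B a (ext d) = 0 \<and> B a (ext d') = 0)"
      by (simp only: bij_betw_imp_surj_on[OF bij])
    also have "\<dots> \<longleftrightarrow> (\<exists>a \<in> aff. B a d = 0 \<and> B a d' = 0)"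
      using ext_mixed[OF _ d(1)] ext_mixed[OF _ d(2)] by (simp add: ext_aff)
    also have "\<dots> \<longleftrightarrow> B d d' \<noteq> 0" using infinity_noncollinear_iff[OF d False] by simp
    finally show ?thesis by blast
  qed
  show ?thesis
    using assms inf ext_mixed[of v w] ext_mixed[of w v] coll[of v w] ext_aff B_sym[of v w]
      B_sym[of "ext v" "ext w"] by auto
qed

lemma ext_span_eq_iff:
  assumes "v \<in> aff \<union> infinity" "w \<in> aff \<union> infinity"
  shows "vec.span {ext v} = vec.span {ext w} \<longleftrightarrow> vec.span {v} = vec.span {w}"
proof -
  have mixed: "vec.span {a} \<noteq> vec.span {d}" if "a \<in> aff" "d \<in> infinity" for a d
    using B_span_zero[of d a p] infinityD(2)[OF that(2)] affD(2)[OF that(1)] Qp by metis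
  have affine: "vec.span {a} = vec.span {b} \<longleftrightarrow> a = b" if "a \<in> aff" "b \<in> aff" for a b
    using aff_independent[OF that] vec.span_base by blast
  show ?thesis
    using assms
    by (elim UnE) (simp_all add: affine \<alpha>_aff \<alpha>_eq_iff ext_aff ext_infinity_eq_iff ext_in_infinity
      mixed mixed[symmetric])
qed

end

section \<open>The geometries in terms of representatives\<close>

context affine_quadric
begin

abbreviation pt :: "'a ^ 6 \<Rightarrow> ('a ^ 6) set" where
  "pt v \<equiv> vec.span {v}"

abbreviation GS where "GS \<equiv> quadric_geometry Q"
abbreviation GS' where "GS' \<equiv> quadric_section Q {v. B p v = 0}"
abbreviation GA where "GA \<equiv> complement_geometry GS GS'"
abbreviation GE where "GE \<equiv> ovoid_geometry GS GS'"

definition reps :: "('a ^ 6) set" where "reps = aff \<union> infinity"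

lemma repsD:
  assumes "v \<in> reps"
  shows "Q v = 0" "B v v = 0" "v \<noteq> 0"
  using assms[unfolded reps_def] affD infinityD aff_nonzero by blast+

lemma pt_subset_iff: "vec.subspace U \<Longrightarrow> pt v \<subseteq> U \<longleftrightarrow> v \<in> U"
  using vec.span_base[of v "{v}"] vec.span_minimal[of "{v}" U] by auto

lemma pt_aff_eq_iff: "a \<in> aff \<Longrightarrow> b \<in> aff \<Longrightarrow> pt a = pt b \<longleftrightarrow> a = b"
  using aff_independent vec.span_base by blast

lemma pt_aff_neq_infinity: "a \<in> aff \<Longrightarrow> d \<in> infinity \<Longrightarrow> pt a \<noteq> pt d"
proof
  assume a: "a \<in> aff" and d: "d \<in> infinity" and "pt a = pt d"
  hence "a \<in> pt d" using vec.span_base by blast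
  then obtain t where "a = t *s d" by (rule in_span1E)
  hence "B p a = 0" using infinityD[OF d] by simp
  thus False using a Qp by simp
qed

lemma singular_has_rep:
  assumes "Q v = 0" "v \<noteq> 0"
  obtains x where "x \<in> reps" "pt x = pt v"
proof (cases "B p v = 0")
  case True
  thus thesis using that[of v] assms by (auto simp: reps_def intro: infinityI)
next
  case False
  let ?x = "(s / B p v) *s v"
  have "?x \<in> aff" by (rule affI) (use assms False in auto)
  moreover have "pt v = pt ?x"
    using span_singleton_eq_iff[OF assms(2) aff_nonzero[OF calculation]] False Qp
    by (metis divide_eq_0_iff)
  ultimately show thesis using that[of ?x] by (auto simp: reps_def)
qed

lemma totally_singular_pt: "v \<in> reps \<Longrightarrow> totally_singular Q (pt v)"
  using repsD by (intro totally_singular_span) auto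

lemma points_GS: "points GS = pt ` reps"
proof (intro equalityI subsetI)
  fix P assume "P \<in> points GS"
  hence P: "totally_singular Q P" "vec.dim P = 1"
    by (auto simp: quadric_geometry_def quadric_section_def)
  have sub: "vec.subspace P" using P by (simp add: totally_singular_def)
  have "\<not> P \<subseteq> {0}" using P(2) vec.dim_eq_0[of P] by linarith
  then obtain v where v: "v \<in> P" "v \<noteq> 0" by blast
  have "P = pt v" using dim_1_span sub P(2) v by blast
  moreover have "Q v = 0" using P v by (simp add: totally_singular_def)
  then obtain x where "x \<in> reps" "pt x = pt v" using v(2) by (rule singular_has_rep)
  ultimately show "P \<in> pt ` reps" by blast
next
  fix P assume "P \<in> pt ` reps"
  then obtain v where v: "v \<in> reps" "P = pt v" by blast
  thus "P \<in> points GS"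
    using totally_singular_pt[OF v(1)] repsD[OF v(1)]
    by (simp add: quadric_geometry_def quadric_section_def)
qed

lemma points_GS': "points GS' = pt ` infinity"
proof -
  have "points GS' = {P \<in> points GS. P \<subseteq> {v. B p v = 0}}"
    by (auto simp: quadric_geometry_def quadric_section_def)
  also have "\<dots> = {P \<in> pt ` reps. P \<subseteq> {v. B p v = 0}}" by (simp only: points_GS)
  also have "\<dots> = pt ` {v \<in> reps. B p v = 0}"
    using pt_subset_iff[OF subspace_perp_vec[of p]] by auto
  also have "{v \<in> reps. B p v = 0} = infinity"
    using Qp infinityD(2) by (auto simp: reps_def)
  finally show ?thesis .
qed

lemma points_GA: "points GA = pt ` aff"
proof -
  have "points GA = pt ` reps - pt ` infinity"
    by (simp only: points_GS[symmetric] points_GS'[symmetric]) (simp add: complement_geometry_def)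
  thus ?thesis using pt_aff_neq_infinity by (auto simp: reps_def)
qed

lemma inc_simps [simp]: "inc GS = (\<subseteq>)" "inc GS' = (\<subseteq>)" "inc GA = (\<subseteq>)" "inc GE = (\<in>)"
  by (simp_all add: quadric_geometry_def quadric_section_def complement_geometry_def ovoid_geometry_def)

lemma lines_GS: "L \<in> lines GS \<longleftrightarrow> totally_singular Q L \<and> vec.dim L = 2"
  by (simp add: quadric_geometry_def quadric_section_def)

lemma lines_GS': "L \<in> lines GS' \<longleftrightarrow> L \<in> lines GS \<and> (\<forall>v \<in> L. B p v = 0)"
  by (auto simp: quadric_geometry_def quadric_section_def)

lemma lines_GA: "L \<in> lines GA \<longleftrightarrow> L \<in> lines GS \<and> (\<exists>v \<in> L. B p v \<noteq> 0)"
  using lines_GS' by (auto simp: complement_geometry_def)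

lemma lines_GS_subspace: "L \<in> lines GS \<Longrightarrow> vec.subspace L"
  by (simp add: lines_GS totally_singular_def)

lemma lines_GA_GS: "L \<in> lines GA \<Longrightarrow> L \<in> lines GS"
  by (simp add: lines_GA)

lemma lines_GS_perp: "L \<in> lines GS \<Longrightarrow> x \<in> L \<Longrightarrow> y \<in> L \<Longrightarrow> B x y = 0"
  using totally_singular_B by (auto simp: lines_GS)

lemma span_line:
  assumes "Q v = 0" "Q w = 0" "B v w = 0" "v \<noteq> 0" "w \<notin> pt v"
  shows "vec.span {v, w} \<in> lines GS"
  unfolding lines_GS
  using assms B_self B_sym[of w v] by (intro conjI totally_singular_span dim_span2) auto

lemma reps_not_in_pt: "v \<in> reps \<Longrightarrow> w \<in> reps \<Longrightarrow> pt v \<noteq> pt w \<Longrightarrow> w \<notin> pt v"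
proof
  assume vw: "v \<in> reps" "w \<in> reps" "pt v \<noteq> pt w" "w \<in> pt v"
  then obtain r where r: "w = r *s v" by (elim in_span1E)
  moreover have "r \<noteq> 0" using r repsD(3)[OF vw(2)] by auto
  ultimately show False using span_singleton_eq_iff repsD(3) vw by blast
qed

lemma line_GS_spanned:
  assumes L: "L \<in> lines GS"
  obtains v w where "v \<in> reps" "w \<in> reps" "v \<in> L" "w \<in> L" "w \<notin> pt v" "L = vec.span {v, w}"
proof -
  have sub: "vec.subspace L" by (rule lines_GS_subspace[OF L])
  have rep: "\<exists>x. x \<in> reps \<and> x \<in> L \<and> pt x = pt v" if v: "v \<in> L" "v \<noteq> 0" for v
  proof -
    have "Q v = 0" using L v by (simp add: lines_GS totally_singular_def)
    then obtain x where x: "x \<in> reps" "pt x = pt v" using v(2) by (rule singular_has_rep)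
    have "pt x \<subseteq> L" using x v pt_subset_iff[OF sub] by simp
    thus ?thesis using x pt_subset_iff[OF sub] by blast
  qed
  have "\<not> L \<subseteq> {0}" using L vec.dim_eq_0[of L] by (simp add: lines_GS)
  then obtain v0 where "v0 \<in> L" "v0 \<noteq> 0" by blast
  then obtain v where v: "v \<in> reps" "v \<in> L" using rep by blast
  have "vec.dim L = 2" using L by (simp add: lines_GS)
  then obtain w0 where w0: "w0 \<in> L" "w0 \<notin> pt v"
    using dim_2_extend[OF sub _ v(2) repsD(3)[OF v(1)]] by metis
  have "w0 \<noteq> 0" using w0(2) vec.span_zero by blast
  then obtain w where w: "w \<in> reps" "w \<in> L" "pt w = pt w0" using rep w0 by blast
  have wv: "w \<notin> pt v"
  proof
    assume "w \<in> pt v"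
    hence "pt w \<subseteq> pt v" using pt_subset_iff by auto
    thus False using w0(2) w(3) vec.span_base by blast
  qed
  have "L = vec.span {v, w}"
    using dim_2_span[OF sub] L v w wv repsD(3) by (simp add: lines_GS)
  thus thesis using that v w wv by blast
qed

lemma line_GS_complete:
  assumes "v \<in> reps" "w \<in> reps" "x \<in> reps" "w \<notin> pt v" "B v w = 0" "B v x = 0" "B w x = 0"
  shows "x \<in> vec.span {v, w}"
  using assms repsD by (intro no_triangle) auto

lemma perp_pt:
  assumes v: "v \<in> reps" and w: "w \<in> reps"
  shows "pt w \<in> perp GS (pt v) \<longleftrightarrow> B v w = 0"
proof
  assume "pt w \<in> perp GS (pt v)"
  then consider "pt w = pt v" | L where "L \<in> lines GS" "pt v \<subseteq> L" "pt w \<subseteq> L"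
    by (auto simp: perp_def)
  thus "B v w = 0"
  proof cases
    case 1
    hence "w \<in> pt v" using vec.span_base by blast
    thus ?thesis using totally_singular_B[OF totally_singular_pt[OF v]] vec.span_base by blast
  next
    case 2
    thus ?thesis using lines_GS_perp vec.span_base by blast
  qed
next
  assume z: "B v w = 0"
  have "pt w = pt v \<or> (\<exists>L \<in> lines GS. pt v \<subseteq> L \<and> pt w \<subseteq> L)"
  proof (cases "pt w = pt v")
    case False
    hence "vec.span {v, w} \<in> lines GS"
      using z v w repsD reps_not_in_pt by (intro span_line) metis+
    moreover have "pt v \<subseteq> vec.span {v, w}" "pt w \<subseteq> vec.span {v, w}" by (auto intro: vec.span_mono[THEN subsetD])
    ultimately show ?thesis by blast
  qed simp
  thus "pt w \<in> perp GS (pt v)" using w points_GS by (auto simp: perp_def)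
qed

section \<open>Subtended ovoids and rosettes\<close>

definition ovoid :: "'a ^ 6 \<Rightarrow> ('a ^ 6) set set" where
  "ovoid a = subtended_ovoid GS GS' (pt a)"

lemma pt_in_ovoid:
  assumes "a \<in> aff" "d \<in> infinity"
  shows "pt d \<in> ovoid a \<longleftrightarrow> B a d = 0"
  using perp_pt[of a d] assms points_GS' by (auto simp: ovoid_def subtended_ovoid_def reps_def)

lemma ovoid_subset: "ovoid a \<subseteq> pt ` infinity"
  using points_GS' by (auto simp: ovoid_def subtended_ovoid_def)

text \<open>Equal ovoids make \<open>b\<close> orthogonal to all singular vectors of
  \<open>perp_space {p, a}\<close>, so \<open>singular_perp_exists\<close> puts \<open>b\<close> in
  the span of \<open>p\<close> and \<open>a\<close>. There \<open>Q b = 0\<close> and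
  \<open>B p b = s\<close> leave only \<open>a\<close> and \<open>p - a\<close>.\<close>

lemma ovoid_eq_iff:
  assumes a: "a \<in> aff" and b: "b \<in> aff"
  shows "ovoid a = ovoid b \<longleftrightarrow> b = a \<or> b = p - a"
proof
  assume eq: "ovoid a = ovoid b"
  obtain y where y: "Q y = 0" "B a y = 0" "y \<notin> pt a"
    using singular_neighbour[of a] a aff_nonzero by auto
  \<comment> \<open>Moving \<open>y\<close> along \<open>a\<close> into the hyperplane keeps it
    singular and orthogonal to \<open>a\<close>; this is the witness that
    \<open>singular_perp_exists\<close> asks for.\<close>
  define v where "v = y - (B p y / s) *s a"
  have v: "Q v = 0" "B p v = 0" "B a v = 0"
    using y a Qp B_sym[of y a] by (simp_all add: v_def Q_diff)
  have "v \<notin> vec.span {p, a}"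
  proof
    assume "v \<in> vec.span {p, a}"
    then obtain t u where tu: "v = t *s p + u *s a" by (rule in_span2E)
    have "t * s = 0" using v(3) a by (simp add: tu)
    hence t: "t = 0" using Qp by simp
    have "u * s = 0" using v(2) a t by (simp add: tu)
    hence "v = 0" using t tu Qp by simp
    hence "y = (B p y / s) *s a" by (simp add: v_def)
    thus False using y(3) unfolding vec.span_singleton by blast
  qed
  moreover have "v \<in> perp_space {p, a}" using v by (simp add: perp_space_def)
  moreover have "B b d = 0" if d: "d \<in> perp_space {p, a}" "Q d = 0" for d
  proof (cases "d = 0")
    case False
    hence di: "d \<in> infinity" using d by (auto simp: perp_space_def intro: infinityI)
    have "B a d = 0" using d by (simp add: perp_space_def)
    thus ?thesis using eq pt_in_ovoid[OF a di] pt_in_ovoid[OF b di] by simp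
  qed simp
  ultimately have "b \<in> vec.span {p, a}"
    using singular_perp_exists v(1) by metis
  then obtain t u where tu: "b = t *s p + u *s a" by (rule in_span2E)
  have "(2 * t + u) * s = s" using affD(2)[OF b] a by (simp add: tu B_self algebra_simps)
  hence "2 * t + u = 1" using Qp by simp
  hence u: "u = 1 - 2 * t" by (simp add: algebra_simps)
  have "t\<^sup>2 * s + t * u * s = 0" using affD(1)[OF b] a by (simp add: tu Q_add algebra_simps)
  hence "t * (1 - t) * s = 0" unfolding u by (simp add: power2_eq_square algebra_simps)
  hence "t = 0 \<or> t = 1" using Qp by simp
  thus "b = a \<or> b = p - a"
  proof
    assume "t = 1"
    moreover from this have "u = -1" using u by simp
    ultimately show ?thesis using tu by simp
  qed (use tu u in simp)
next
  have "ovoid (p - a) \<subseteq> ovoid a" if "a \<in> aff" for a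
    using ovoid_subset[of "p - a"] pt_in_ovoid[OF twin_aff[OF that]] pt_in_ovoid[OF that]
    by (auto simp: infinityD)
  from this[OF a] this[OF twin_aff[OF a]] have "ovoid (p - a) = ovoid a" by simp
  thus "b = a \<or> b = p - a \<Longrightarrow> ovoid a = ovoid b" by auto
qed

lemma points_on_GA:
  assumes "vec.subspace L"
  shows "points_on GA L = pt ` (aff \<inter> L)"
  using pt_subset_iff[OF assms] by (auto simp: points_on_def points_GA)

lemma rosette_eq:
  assumes "vec.subspace L"
  shows "rosette GS GS' L = ovoid ` (aff \<inter> L)"
  unfolding rosette_def points_on_GA[OF assms] by (auto simp: ovoid_def)

lemma aff_span_ray:
  assumes "a \<in> aff" "b \<in> aff" "B a b = 0"
  shows "aff \<inter> vec.span {a, b} = ray a (b - a)"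
proof (intro equalityI subsetI)
  fix x assume "x \<in> aff \<inter> vec.span {a, b}"
  thus "x \<in> ray a (b - a)" using aff_span2[OF assms(1,2)] unfolding ray_def by blast
next
  fix x assume "x \<in> ray a (b - a)"
  then obtain t where t: "x = a + t *s (b - a)" by (auto simp: ray_def)
  have "a + t *s (b - a) = (1 - t) *s a + t *s b"
    by (simp add: vec.scale_left_diff_distrib vec.scale_right_diff_distrib)
  hence "x \<in> vec.span {a, b}" using t in_span2I by metis
  thus "x \<in> aff \<inter> vec.span {a, b}" using t aff_line_point[OF assms] by simp
qed

lemma line_GA_spanned:
  assumes L: "L \<in> lines GA" and a: "a \<in> aff" "a \<in> L" and b: "b \<in> aff" "b \<in> L" "a \<noteq> b"
  shows "L = vec.span {a, b}" "B a b = 0"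
proof -
  have GS: "L \<in> lines GS" by (rule lines_GA_GS[OF L])
  show "L = vec.span {a, b}"
    using GS a b aff_independent[OF a(1) b(1,3)] aff_nonzero
    by (intro dim_2_span lines_GS_subspace) (auto simp: lines_GS)
  show "B a b = 0" using lines_GS_perp[OF GS a(2) b(2)] .
qed

lemma span_line_GA:
  assumes "a \<in> aff" "b \<in> aff" "a \<noteq> b" "B a b = 0"
  shows "vec.span {a, b} \<in> lines GA"
proof -
  have "vec.span {a, b} \<in> lines GS"
    using assms aff_nonzero aff_independent by (intro span_line) auto
  moreover have "a \<in> vec.span {a, b}" by (simp add: vec.span_base)
  ultimately show ?thesis using assms(1) Qp by (force simp: lines_GA)
qed

lemma rosette_span:
  assumes "a \<in> aff" "b \<in> aff" "B a b = 0"
  shows "rosette GS GS' (vec.span {a, b}) = ovoid ` ray a (b - a)"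
  using rosette_eq[of "vec.span {a, b}"] aff_span_ray[OF assms] by simp

text \<open>The line \<open>M\<close> contains \<open>e\<close> or its twin, and \<open>e'\<close>
  or its twin. Since \<open>e\<close> is not orthogonal to \<open>p - e'\<close>, the choices agree,
  so \<open>M\<close> is the line of \<open>e\<close> and \<open>e'\<close> or its reflection, and
  these have the same rosette.\<close>

lemma rosette_unique:
  assumes M: "M \<in> lines GA" and e: "e \<in> aff" "e' \<in> aff" "e \<noteq> e'" "B e e' = 0"
    and o: "ovoid e \<in> rosette GS GS' M" "ovoid e' \<in> rosette GS GS' M"
  shows "rosette GS GS' M = rosette GS GS' (vec.span {e, e'})"
proof -
  have subM: "vec.subspace M" using lines_GS_subspace lines_GA_GS M by blast
  obtain m m' where m: "m \<in> aff" "m \<in> M" "m = e \<or> m = p - e" "m' \<in> aff" "m' \<in> M" "m' = e' \<or> m' = p - e'"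
    using o ovoid_eq_iff e unfolding rosette_eq[OF subM] by blast
  have mm: "B m m' = 0" using lines_GS_perp[OF lines_GA_GS[OF M]] m by blast
  have z: "B (p - e) e' \<noteq> 0" "B e (p - e') \<noteq> 0" using e Qp by auto
  have "(m = e \<and> m' = e') \<or> (m = p - e \<and> m' = p - e')" using m(3,6) mm z by metis
  thus ?thesis
  proof
    assume "m = e \<and> m' = e'"
    thus ?thesis using line_GA_spanned(1)[OF M e(1) _ e(2) _ e(3)] m by simp
  next
    assume mt: "m = p - e \<and> m' = p - e'"
    have "M = vec.span {p - e, p - e'}"
      using line_GA_spanned(1)[OF M m(1,2,4,5)] mt e(3) by auto
    hence "rosette GS GS' M = ovoid ` ray (p - e) (p - e' - (p - e))"
      using rosette_span[of "p - e" "p - e'"] e mm mt by simp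
    also have "ray (p - e) (p - e' - (p - e)) = (\<lambda>x. p - x) ` ray e (e' - e)"
    proof -
      have "p - e + t *s (p - e' - (p - e)) = p - (e + t *s (e' - e))" for t
        by (simp add: vec.scale_right_diff_distrib)
      thus ?thesis unfolding ray_def image_image by (rule image_cong[OF refl])
    qed
    also have "ovoid ` (\<lambda>x. p - x) ` ray e (e' - e) = ovoid ` ray e (e' - e)"
    proof -
      have "ovoid (p - x) = ovoid x" if "x \<in> ray e (e' - e)" for x
      proof -
        have "x \<in> aff" using that aff_span_ray[OF e(1,2,4)] by blast
        thus ?thesis using ovoid_eq_iff[of x "p - x"] by simp
      qed
      thus ?thesis unfolding image_image by (rule image_cong[OF refl])
    qed
    also have "\<dots> = rosette GS GS' (vec.span {e, e'})" using rosette_span e by simp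
    finally show ?thesis .
  qed
qed

lemma points_GE: "points GE = ovoid ` aff"
  by (simp add: ovoid_geometry_def points_GA image_image ovoid_def)

lemma lines_GE: "lines GE = rosette GS GS' ` lines GA"
  by (simp add: ovoid_geometry_def)

lemma points_on_GE:
  assumes "M \<in> lines GA"
  shows "points_on GE (rosette GS GS' M) = rosette GS GS' M"
  using rosette_eq[of M] lines_GS_subspace lines_GA_GS assms
  by (auto simp: points_on_def points_GE)

end

section \<open>Covers of the ovoid geometry\<close>

locale ovoid_cover = affine_quadric Q p
  for Q :: "'a::{field,finite} ^ 6 \<Rightarrow> 'a" and p +
  fixes \<gamma>\<^sub>P :: "('a ^ 6) set \<Rightarrow> ('a ^ 6) set set"
    and \<gamma>\<^sub>L :: "('a ^ 6) set \<Rightarrow> ('a ^ 6) set set set"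
  assumes cover: "cover GA GE \<gamma>\<^sub>P \<gamma>\<^sub>L"
begin

definition over :: "'a ^ 6 \<Rightarrow> 'a ^ 6 \<Rightarrow> bool" where
  "over a e \<longleftrightarrow> a \<in> aff \<and> e \<in> aff \<and> \<gamma>\<^sub>P (pt a) = ovoid e"

lemma overD: "over a e \<Longrightarrow> a \<in> aff" "over a e \<Longrightarrow> e \<in> aff" "over a e \<Longrightarrow> \<gamma>\<^sub>P (pt a) = ovoid e"
  by (simp_all add: over_def)

lemma over_total: "a \<in> aff \<Longrightarrow> \<exists>e. over a e"
proof -
  assume a: "a \<in> aff"
  have "\<gamma>\<^sub>P ` points GA \<subseteq> points GE" using cover by (simp add: cover_def morphism_def)
  hence "\<gamma>\<^sub>P (pt a) \<in> ovoid ` aff" unfolding points_GA points_GE using a by auto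
  thus ?thesis using a by (auto simp: over_def)
qed

lemma over_twin:
  assumes "over a e"
  shows "over a e' \<longleftrightarrow> e' = e \<or> e' = p - e"
proof -
  have e: "a \<in> aff" "e \<in> aff" "\<gamma>\<^sub>P (pt a) = ovoid e" using assms by (auto dest: overD)
  have "over a e' \<longleftrightarrow> e' \<in> aff \<and> ovoid e = ovoid e'" using e by (simp add: over_def)
  thus ?thesis using ovoid_eq_iff[OF e(2)] e(2) twin_aff by metis
qed

lemma image_line:
  assumes L: "L \<in> lines GA"
  obtains M where "M \<in> lines GA" "\<gamma>\<^sub>L L = rosette GS GS' M"
    "bij_betw \<gamma>\<^sub>P (pt ` (aff \<inter> L)) (rosette GS GS' M)"
proof -
  have "\<gamma>\<^sub>L ` lines GA \<subseteq> lines GE" using cover by (simp add: cover_def morphism_def)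
  hence "\<gamma>\<^sub>L L \<in> lines GE" using L by blast
  then obtain M where M: "M \<in> lines GA" "\<gamma>\<^sub>L L = rosette GS GS' M" using lines_GE by blast
  have "bij_betw \<gamma>\<^sub>P (points_on GA L) (points_on GE (\<gamma>\<^sub>L L))" using cover L by (simp add: cover_def)
  hence "bij_betw \<gamma>\<^sub>P (pt ` (aff \<inter> L)) (rosette GS GS' M)"
    using points_on_GA lines_GS_subspace lines_GA_GS L points_on_GE[OF M(1)] M(2) by simp
  thus thesis using that M by blast
qed

lemma over_in_image:
  assumes "L \<in> lines GA" "over a e" "a \<in> L"
  shows "ovoid e \<in> \<gamma>\<^sub>L L"
proof -
  obtain M where M: "\<gamma>\<^sub>L L = rosette GS GS' M" "bij_betw \<gamma>\<^sub>P (pt ` (aff \<inter> L)) (rosette GS GS' M)"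
    using image_line[OF assms(1)] .
  have "pt a \<in> pt ` (aff \<inter> L)" using assms overD by blast
  hence "\<gamma>\<^sub>P (pt a) \<in> rosette GS GS' M" using M(2) by (auto simp: bij_betw_def)
  thus ?thesis using M(1) overD(3)[OF assms(2)] by simp
qed

lemma over_inj:
  assumes "L \<in> lines GA" "over a e" "a \<in> L" "over a' e" "a' \<in> L"
  shows "a = a'"
proof -
  obtain M where "bij_betw \<gamma>\<^sub>P (pt ` (aff \<inter> L)) (rosette GS GS' M)"
    using image_line[OF assms(1)] .
  hence "inj_on \<gamma>\<^sub>P (pt ` (aff \<inter> L))" by (rule bij_betw_imp_inj_on)
  moreover have "\<gamma>\<^sub>P (pt a) = \<gamma>\<^sub>P (pt a')" using overD(3) assms by simp
  moreover have "pt a \<in> pt ` (aff \<inter> L)" "pt a' \<in> pt ` (aff \<inter> L)" using overD(1) assms by blast+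
  ultimately have "pt a = pt a'" by (rule inj_onD)
  thus ?thesis using pt_aff_eq_iff overD assms by blast
qed

lemma over_neq:
  assumes "over a e" "over a' e'" "a \<noteq> a'" "B a a' = 0"
  shows "e' \<noteq> e" "e' \<noteq> p - e"
proof -
  have L: "vec.span {a, a'} \<in> lines GA" using assms overD by (intro span_line_GA) auto
  have "\<not> over a' e" using over_inj[OF L assms(1) _ _] assms(3) by (auto simp: vec.span_base)
  hence "e \<noteq> e'" "e \<noteq> p - e'" using over_twin[OF assms(2), of e] by blast+
  thus "e' \<noteq> e" "e' \<noteq> p - e" by (metis, metis diff_diff_eq2 add_diff_cancel_left')
qed

lemma over_near:
  assumes "over a e" "over a' e'" "B a a' = 0"
  shows "near e e'"
proof (cases "a = a'")
  case True
  hence "e' = e \<or> e' = p - e" using over_twin[OF assms(1)] assms(2) by blast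
  thus ?thesis using overD(2)[OF assms(1)] by auto
next
  case False
  have L: "vec.span {a, a'} \<in> lines GA" using assms overD False by (intro span_line_GA) auto
  obtain M where M: "M \<in> lines GA" "\<gamma>\<^sub>L (vec.span {a, a'}) = rosette GS GS' M"
    using image_line[OF L] by metis
  have "ovoid e \<in> rosette GS GS' M" "ovoid e' \<in> rosette GS GS' M"
    using over_in_image[OF L] assms M(2) by (simp_all add: vec.span_base)
  then obtain m m' where m: "m \<in> aff" "m \<in> M" "ovoid e = ovoid m" "m' \<in> aff" "m' \<in> M" "ovoid e' = ovoid m'"
    unfolding rosette_eq[OF lines_GS_subspace[OF lines_GA_GS[OF M(1)]]] by blast
  have "B m m' = 0" using lines_GS_perp[OF lines_GA_GS[OF M(1)]] m by blast
  hence "near m m'" by (simp add: near_def)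
  moreover have "m = e \<or> m = p - e" "m' = e' \<or> m' = p - e'"
    using m ovoid_eq_iff overD(2) assms by blast+
  ultimately show ?thesis using near_twin overD(2) assms by (metis twin_aff)
qed

lemma line_image:
  assumes "over a e" "over a' e'" "a \<noteq> a'" "B a a' = 0" "B e e' = 0"
  shows "\<gamma>\<^sub>L (vec.span {a, a'}) = rosette GS GS' (vec.span {e, e'})"
proof -
  have L: "vec.span {a, a'} \<in> lines GA" using assms overD by (intro span_line_GA) auto
  obtain M where M: "M \<in> lines GA" "\<gamma>\<^sub>L (vec.span {a, a'}) = rosette GS GS' M"
    using image_line[OF L] by metis
  have "ovoid e \<in> rosette GS GS' M" "ovoid e' \<in> rosette GS GS' M"
    using over_in_image[OF L] assms M(2) by (simp_all add: vec.span_base)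
  thus ?thesis
    using rosette_unique[OF M(1) overD(2)[OF assms(1)] overD(2)[OF assms(2)] _ assms(5)]
      over_neq[OF assms(1-4)] M(2) by auto
qed

lemma lines_on_bij:
  assumes "over a e"
  shows "bij_betw \<gamma>\<^sub>L {L \<in> lines GA. a \<in> L} {R \<in> lines GE. ovoid e \<in> R}"
proof -
  have "pt a \<in> points GA" using points_GA overD(1)[OF assms] by blast
  hence "bij_betw \<gamma>\<^sub>L (lines_on GA (pt a)) (lines_on GE (\<gamma>\<^sub>P (pt a)))"
    using cover by (simp add: cover_def)
  moreover have "lines_on GA (pt a) = {L \<in> lines GA. a \<in> L}"
    using pt_subset_iff lines_GS_subspace lines_GA_GS by (auto simp: lines_on_def)
  moreover have "lines_on GE (\<gamma>\<^sub>P (pt a)) = {R \<in> lines GE. ovoid e \<in> R}"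
    using overD(3)[OF assms] by (simp add: lines_on_def)
  ultimately show ?thesis by simp
qed

text \<open>The rosette through the two ovoids is the image of a line on \<open>a\<close>, by
  bijectivity on the lines at \<open>a\<close>; that line has a point mapped to the ovoid of
  \<open>e'\<close>.\<close>

lemma over_lift:
  assumes "over a e" "e' \<in> aff" "near e e'"
  shows "\<exists>a'. over a' e' \<and> B a a' = 0"
proof (cases "e' = e \<or> e' = p - e")
  case True
  hence "over a e'" using over_twin[OF assms(1)] by simp
  moreover have "B a a = 0" using overD(1)[OF assms(1)] by simp
  ultimately show ?thesis by blast
next
  case False
  have e: "e \<in> aff" "a \<in> aff" using overD assms by blast+
  \<comment> \<open>The member of the twin pair that is orthogonal to \<open>e\<close>, so that both
    span a line of the affine quadrangle.\<close>
  define f where "f = (if B e e' = 0 then e' else p - e')"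
  have f: "f \<in> aff" "B e f = 0" "e \<noteq> f" "ovoid f = ovoid e'"
    using False assms e ovoid_eq_iff[of e' f] by (auto simp: f_def near_def)
  let ?M = "vec.span {e, f}"
  have M: "?M \<in> lines GA" using e f by (intro span_line_GA) auto
  have eM: "ovoid e \<in> rosette GS GS' ?M" "ovoid f \<in> rosette GS GS' ?M"
    unfolding rosette_eq[OF vec.subspace_span] using e f by (auto simp: vec.span_base)
  have "rosette GS GS' ?M \<in> {R \<in> lines GE. ovoid e \<in> R}" using M eM lines_GE by blast
  hence "rosette GS GS' ?M \<in> \<gamma>\<^sub>L ` {L \<in> lines GA. a \<in> L}"
    by (simp only: bij_betw_imp_surj_on[OF lines_on_bij[OF assms(1)]])
  then obtain L where "rosette GS GS' ?M = \<gamma>\<^sub>L L" "L \<in> {L \<in> lines GA. a \<in> L}" by (rule imageE)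
  hence L: "L \<in> lines GA" "a \<in> L" "\<gamma>\<^sub>L L = rosette GS GS' ?M" by simp_all
  obtain N where "\<gamma>\<^sub>L L = rosette GS GS' N" "bij_betw \<gamma>\<^sub>P (pt ` (aff \<inter> L)) (rosette GS GS' N)"
    using image_line[OF L(1)] .
  hence "ovoid f \<in> \<gamma>\<^sub>P ` pt ` (aff \<inter> L)" using eM(2) L(3) by (simp add: bij_betw_def)
  then obtain a' where a': "a' \<in> aff" "a' \<in> L" "\<gamma>\<^sub>P (pt a') = ovoid e'" using f(4) by auto
  hence "over a' e'" using assms(2) by (simp add: over_def)
  moreover have "B a a' = 0" using lines_GS_perp[OF lines_GA_GS[OF L(1)] L(2) a'(2)] .
  ultimately show ?thesis by blast
qed

lemma same_line:
  assumes "over a e" "\<gamma>\<^sub>L L = \<gamma>\<^sub>L L'" "L \<in> lines GA" "L' \<in> lines GA" "a \<in> L" "a \<in> L'"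
  shows "L = L'"
  using inj_onD[OF bij_betw_imp_inj_on[OF lines_on_bij[OF assms(1)]] assms(2)] assms(3-6) by simp

text \<open>The lines joining \<open>a\<close> to \<open>a'\<close> and to \<open>b'\<close> have
  the same image, so they coincide by injectivity on the lines at \<open>a\<close>; injectivity on
  the points of that line finishes.\<close>

lemma over_unique:
  assumes o: "over a e" "over a' e'" "over b' e'" and z: "B a a' = 0" "B a b' = 0"
  shows "a' = b'"
proof (cases "a' = a \<or> b' = a")
  case True
  thus ?thesis using over_neq[OF o(1,2)] over_neq[OF o(1,3)] z over_twin[OF o(1)] o by metis
next
  case False
  define f where "f = (if B e e' = 0 then e' else p - e')"
  have aff: "e \<in> aff" "e' \<in> aff" using overD(2) o by blast+
  have "near e e'" using over_near[OF o(1,2) z(1)] .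
  hence f: "B e f = 0" "over a' f" "over b' f"
    using aff over_twin[OF o(2)] over_twin[OF o(3)] by (auto simp: f_def near_def)
  have neq: "a \<noteq> a'" "a \<noteq> b'" using False by auto
  have L: "vec.span {a, a'} \<in> lines GA" "vec.span {a, b'} \<in> lines GA"
    using o overD(1) neq z by (auto intro: span_line_GA)
  have "\<gamma>\<^sub>L (vec.span {a, a'}) = \<gamma>\<^sub>L (vec.span {a, b'})"
    using line_image[OF o(1) f(2) neq(1) z(1) f(1)] line_image[OF o(1) f(3) neq(2) z(2) f(1)] by simp
  hence eq: "vec.span {a, a'} = vec.span {a, b'}"
    using same_line[OF o(1) _ L] by (simp add: vec.span_base)
  have "b' \<in> vec.span {a, a'}" unfolding eq by (simp add: vec.span_base)
  thus ?thesis using over_inj[OF L(1) o(2) _ o(3)] by (simp add: vec.span_base)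
qed

text \<open>Two lines through \<open>a'\<close> coincide iff their images do. The orthogonality
  assumptions on \<open>e\<close>, \<open>e'\<close>, \<open>e''\<close> select the twins that lie
  on the lines of the stated spans.\<close>

lemma over_line:
  assumes o: "over a e" "over a' e'" "over a'' e''" and z: "B a a' = 0" "B a' a'' = 0"
    and y: "B e e' = 0" "B e' e'' = 0"
  shows "B a a'' = 0 \<longleftrightarrow> B e e'' = 0"
proof -
  have aff: "a \<in> aff" "a' \<in> aff" "a'' \<in> aff" "e \<in> aff" "e' \<in> aff" "e'' \<in> aff" using overD o by blast+
  \<comment> \<open>For pairs collinear above and below, coincidence above and below are equivalent;
    this settles the degenerate cases.\<close>
  have down: "x = x' \<longleftrightarrow> f = f'" if x: "over x f" "over x' f'" and zz: "B x x' = 0" "B f f' = 0" for x x' f f'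
  proof
    assume "x = x'"
    hence "f' = f \<or> f' = p - f" using over_twin[OF x(1)] x(2) by simp
    thus "f = f'" using zz(2) overD(2)[OF x(1)] Qp by auto
  next
    assume "f = f'"
    thus "x = x'" using over_neq(1)[OF x _ zz(1)] by auto
  qed
  have y': "B e' e = 0" "B e'' e' = 0" and z': "B a' a = 0" "B a'' a' = 0" using y z B_sym by metis+
  show ?thesis
  proof (cases "a = a' \<or> a' = a''")
    case True
    thus ?thesis using down[OF o(1,2) z(1) y(1)] down[OF o(2,3) z(2) y(2)] y z by auto
  next
    case False
    hence ne: "a \<noteq> a'" "a' \<noteq> a''" "e \<noteq> e'" "e' \<noteq> e''"
      using down[OF o(1,2) z(1) y(1)] down[OF o(2,3) z(2) y(2)] by auto
    have L: "vec.span {a', a} \<in> lines GA" "vec.span {a', a''} \<in> lines GA"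
      using aff ne z z' by (auto intro!: span_line_GA)
    have ne': "a' \<noteq> a" using ne by simp
    note im = line_image[OF o(2,1) ne' z'(1) y'(1)] line_image[OF o(2,3) ne(2) z(2) y(2)]
    show ?thesis
    proof
      assume ee: "B e e'' = 0"
      have M: "vec.span {e', e} \<in> lines GA" using aff ne y' by (intro span_line_GA) auto
      have "e'' \<in> ray e' (e - e')" using aff y y' ee ne by (intro ray_unique) auto
      hence "e'' \<in> vec.span {e', e}" using aff_span_ray[of e' e] aff y' by blast
      hence "vec.span {e', e} = vec.span {e', e''}"
        using line_GA_spanned(1)[OF M, of e' e''] aff ne by (simp add: vec.span_base)
      hence "vec.span {a', a} = vec.span {a', a''}"
        using same_line[OF o(2) _ L] im by (simp add: vec.span_base)
      hence "a \<in> vec.span {a', a''}" "a'' \<in> vec.span {a', a''}" using vec.span_base by blast+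
      thus "B a a'' = 0" using lines_GS_perp[OF lines_GA_GS[OF L(2)]] by blast
    next
      assume aa: "B a a'' = 0"
      have "a'' \<in> ray a' (a - a')" using aff z z' aa ne by (intro ray_unique) auto
      hence "a'' \<in> vec.span {a', a}" using aff_span_ray[of a' a] aff z' by blast
      hence "ovoid e'' \<in> rosette GS GS' (vec.span {e', e})"
        using over_in_image[OF L(1) o(3)] im(1) by simp
      then obtain m where m: "m \<in> vec.span {e', e}" "m = e'' \<or> m = p - e''"
        unfolding rosette_eq[OF vec.subspace_span] using ovoid_eq_iff aff by blast
      have M: "vec.span {e', e} \<in> lines GS"
        using aff ne y' span_line_GA[of e' e] lines_GA_GS by auto
      have "B e' m = 0" "B e m = 0" using lines_GS_perp[OF M] m(1) vec.span_base by blast+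
      moreover from this have "m = e''" using m(2) y aff Qp by auto
      ultimately show "B e e'' = 0" by simp
    qed
  qed
qed

sublocale affine_cover Q p over
  by unfold_locales (fact overD over_total over_twin over_near over_lift over_unique over_line)+

end

section \<open>The induced automorphism of the whole quadrangle\<close>

context affine_automorphism
begin

definition rep :: "('a ^ 6) set \<Rightarrow> 'a ^ 6" where
  "rep P = (SOME v. v \<in> reps \<and> P = pt v)"

definition point_map :: "('a ^ 6) set \<Rightarrow> ('a ^ 6) set" where
  "point_map P = pt (ext (rep P))"

text \<open>As \<open>ext\<close> is not known to be linear, the image is defined as a span;
  \<open>line_map_line\<close> shows that it is again a line.\<close>

definition line_map :: "('a ^ 6) set \<Rightarrow> ('a ^ 6) set" where
  "line_map L = vec.span (ext ` (reps \<inter> L))"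

lemma point_map_pt:
  assumes "v \<in> reps"
  shows "point_map (pt v) = pt (ext v)"
proof -
  have "\<exists>w. w \<in> reps \<and> pt v = pt w" using assms by blast
  hence "rep (pt v) \<in> reps" "pt v = pt (rep (pt v))"
    unfolding rep_def by (rule someI2_ex, simp)+
  thus ?thesis using ext_span_eq_iff assms by (simp add: point_map_def reps_def)
qed

lemma ext_reps: "v \<in> reps \<Longrightarrow> ext v \<in> reps"
  using ext_in_infinity ext_aff \<alpha>_aff by (auto simp: reps_def)

lemma point_map_points: "bij_betw point_map (points GS) (points GS)" "point_map ` points GS' = points GS'"
proof -
  have inj: "inj_on point_map (points GS)"
    unfolding points_GS by (rule inj_onI) (auto simp: point_map_pt ext_span_eq_iff reps_def)
  have "point_map ` points GS \<subseteq> points GS"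
    unfolding points_GS by (auto simp: point_map_pt ext_reps)
  hence "point_map ` points GS = points GS" using inj by (intro endo_inj_surj) auto
  thus "bij_betw point_map (points GS) (points GS)" using inj by (simp add: bij_betw_def)
  have sub: "points GS' \<subseteq> points GS" by (auto simp: points_GS points_GS' reps_def)
  have "point_map ` points GS' \<subseteq> points GS'"
    unfolding points_GS' using point_map_pt ext_in_infinity by (auto simp: reps_def)
  thus "point_map ` points GS' = points GS'"
    using inj_on_subset[OF inj sub] by (intro endo_inj_surj) auto
qed

text \<open>The images of two spanning representatives are orthogonal and independent. The image of
  any other representative on the line is orthogonal to both, so it lies in their span by the
  absence of triangles.\<close>

lemma line_map_line:
  assumes L: "L \<in> lines GS"
  shows "line_map L \<in> lines GS" "x \<in> reps \<Longrightarrow> ext x \<in> line_map L \<longleftrightarrow> x \<in> L"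
proof -
  obtain v w where vw: "v \<in> reps" "w \<in> reps" "v \<in> L" "w \<in> L" "w \<notin> pt v" "L = vec.span {v, w}"
    using line_GS_spanned[OF L] .
  have Bvw: "B v w = 0" using lines_GS_perp[OF L vw(3,4)] .
  have e: "ext v \<in> reps" "ext w \<in> reps" using ext_reps vw by auto
  have perp: "B (ext x) (ext y) = 0 \<longleftrightarrow> B x y = 0" if "x \<in> reps" "y \<in> reps" for x y
    using ext_perp that by (simp add: reps_def)
  have "pt v \<noteq> pt w" using vw(5) vec.span_base by blast
  hence "pt (ext v) \<noteq> pt (ext w)" using ext_span_eq_iff vw by (simp add: reps_def)
  hence ew: "ext w \<notin> pt (ext v)" using reps_not_in_pt e by blast
  have "ext x \<in> vec.span {ext v, ext w}" if "x \<in> reps" "x \<in> L" for x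
    using that vw e ew Bvw ext_reps lines_GS_perp[OF L] by (intro line_GS_complete) (auto simp: perp)
  hence "line_map L \<subseteq> vec.span {ext v, ext w}"
    unfolding line_map_def by (intro vec.span_minimal) auto
  moreover have "vec.span {ext v, ext w} \<subseteq> line_map L"
    unfolding line_map_def using vw by (intro vec.span_mono) auto
  ultimately have eq: "line_map L = vec.span {ext v, ext w}" by blast
  show 1: "line_map L \<in> lines GS"
    unfolding eq using e ew Bvw vw repsD by (intro span_line) (auto simp: perp)
  show "ext x \<in> line_map L \<longleftrightarrow> x \<in> L" if x: "x \<in> reps"
  proof
    assume "x \<in> L"
    thus "ext x \<in> line_map L" unfolding line_map_def using x by (auto intro: vec.span_base)
  next
    assume xL: "ext x \<in> line_map L"
    have "ext v \<in> line_map L" "ext w \<in> line_map L" unfolding eq by (simp_all add: vec.span_base)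
    hence "B v x = 0" "B w x = 0" using lines_GS_perp[OF 1 _ xL] perp x vw by blast+
    thus "x \<in> L" unfolding vw(6) using vw x Bvw by (intro line_GS_complete) auto
  qed
qed

lemma line_map_inj: "inj_on line_map (lines GS)"
proof (rule inj_onI)
  fix L M assume LM: "L \<in> lines GS" "M \<in> lines GS" "line_map L = line_map M"
  have mem: "x \<in> L \<longleftrightarrow> x \<in> M" if "x \<in> reps" for x
    using line_map_line(2)[OF LM(1) that] line_map_line(2)[OF LM(2) that] LM(3) by simp
  have sub: "L \<subseteq> M" if LS: "L \<in> lines GS" "M \<in> lines GS" "\<And>x. x \<in> reps \<Longrightarrow> x \<in> L \<Longrightarrow> x \<in> M" for L M
  proof -
    obtain v w where "v \<in> reps" "w \<in> reps" "v \<in> L" "w \<in> L" "L = vec.span {v, w}"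
      using line_GS_spanned[OF LS(1)] by metis
    thus ?thesis using LS(3) vec.span_minimal[of "{v, w}" M] lines_GS_subspace[OF LS(2)] by simp
  qed
  show "L = M" using sub[of L M] sub[of M L] mem LM by blast
qed

lemma line_map_lines: "bij_betw line_map (lines GS) (lines GS)" "line_map ` lines GS' = lines GS'"
proof -
  have "line_map ` lines GS = lines GS"
    using line_map_line(1) line_map_inj by (intro endo_inj_surj) auto
  thus "bij_betw line_map (lines GS) (lines GS)" using line_map_inj by (simp add: bij_betw_def)
  have "line_map L \<in> lines GS'" if L: "L \<in> lines GS'" for L
  proof -
    have LS: "L \<in> lines GS" "\<forall>v \<in> L. B p v = 0" using L lines_GS' by auto
    have "reps \<inter> L \<subseteq> infinity" using LS(2) Qp by (auto simp: reps_def)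
    hence "ext ` (reps \<inter> L) \<subseteq> {v. B p v = 0}" using ext_in_infinity infinityD(2) by blast
    hence "line_map L \<subseteq> {v. B p v = 0}"
      unfolding line_map_def by (rule vec.span_minimal) (rule subspace_perp_vec)
    thus ?thesis using line_map_line(1)[OF LS(1)] lines_GS' by blast
  qed
  moreover have "inj_on line_map (lines GS')"
    using line_map_inj lines_GS' by (auto intro: inj_on_subset)
  ultimately show "line_map ` lines GS' = lines GS'" by (intro endo_inj_surj) auto
qed

theorem extends_to_automorphism:
  "automorphism GS point_map line_map" "stabilizes point_map line_map GS'"
proof -
  have "point_map P \<subseteq> line_map L \<longleftrightarrow> P \<subseteq> L" if "P \<in> points GS" and L: "L \<in> lines GS" for P L
  proof -
    obtain v where v: "v \<in> reps" "P = pt v" using \<open>P \<in> points GS\<close> points_GS by blast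
    have "vec.subspace (line_map L)" "vec.subspace L"
      using line_map_line(1) L lines_GS_subspace by blast+
    thus ?thesis using line_map_line(2)[OF L v(1)] v by (simp add: point_map_pt pt_subset_iff)
  qed
  thus "automorphism GS point_map line_map"
    using point_map_points(1) line_map_lines(1) by (simp add: automorphism_def)
  show "stabilizes point_map line_map GS'"
    using point_map_points(2) line_map_lines(2) by (simp add: stabilizes_def)
qed

lemma rosette_line_map:
  assumes L: "L \<in> lines GS"
  shows "rosette GS GS' (line_map L) = ovoid ` \<alpha> ` (aff \<inter> L)"
proof -
  have "aff \<inter> line_map L = \<alpha> ` (aff \<inter> L)"
  proof (intro equalityI subsetI)
    fix y assume y: "y \<in> aff \<inter> line_map L"
    then obtain x where x: "x \<in> aff" "\<alpha> x = y" using \<alpha>_surj by blast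
    have "x \<in> L" using line_map_line(2)[OF L, of x] x y by (simp add: reps_def ext_aff)
    thus "y \<in> \<alpha> ` (aff \<inter> L)" using x by blast
  next
    fix y assume "y \<in> \<alpha> ` (aff \<inter> L)"
    then obtain x where x: "x \<in> aff" "x \<in> L" "y = \<alpha> x" by blast
    thus "y \<in> aff \<inter> line_map L"
      using line_map_line(2)[OF L, of x] \<alpha>_aff by (simp add: reps_def ext_aff)
  qed
  thus ?thesis using rosette_eq lines_GS_subspace line_map_line(1)[OF L] by simp
qed

end

section \<open>The factorization of the cover\<close>

theorem (in ovoid_cover) cover_factors:
  "\<exists>\<alpha>\<^sub>P \<alpha>\<^sub>L. automorphism GS \<alpha>\<^sub>P \<alpha>\<^sub>L \<and> stabilizes \<alpha>\<^sub>P \<alpha>\<^sub>L GS' \<and>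
     (\<forall>x \<in> points GA. \<gamma>\<^sub>P x = subtended_ovoid GS GS' (\<alpha>\<^sub>P x)) \<and>
     (\<forall>L \<in> lines GA. \<gamma>\<^sub>L L = rosette GS GS' (\<alpha>\<^sub>L L))"
proof -
  obtain \<alpha> where \<alpha>: "bij_betw \<alpha> aff aff" "\<forall>a \<in> aff. over a (\<alpha> a)"
    "\<forall>a \<in> aff. \<forall>b \<in> aff. B (\<alpha> a) (\<alpha> b) = 0 \<longleftrightarrow> B a b = 0"
    using cover_factorization by blast
  interpret affine_automorphism Q p \<alpha> by unfold_locales (use \<alpha> in auto)
  have pts: "\<gamma>\<^sub>P (pt a) = ovoid (\<alpha> a)" if "a \<in> aff" for a using \<alpha>(2) overD(3) that by blast
  have "\<gamma>\<^sub>P x = subtended_ovoid GS GS' (point_map x)" if x: "x \<in> points GA" for x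
  proof -
    obtain a where a: "a \<in> aff" "x = pt a" using x points_GA by blast
    hence "point_map x = pt (\<alpha> a)" using point_map_pt[of a] by (simp add: reps_def ext_aff)
    thus ?thesis using pts[OF a(1)] a(2) by (simp add: ovoid_def)
  qed
  \<comment> \<open>A rosette is the set of its ovoids, so the image of a line is determined by the
    images of its points.\<close>
  moreover have "\<gamma>\<^sub>L L = rosette GS GS' (line_map L)" if L: "L \<in> lines GA" for L
  proof -
    obtain M where M: "\<gamma>\<^sub>L L = rosette GS GS' M" "bij_betw \<gamma>\<^sub>P (pt ` (aff \<inter> L)) (rosette GS GS' M)"
      using image_line[OF L] .
    have "\<gamma>\<^sub>L L = \<gamma>\<^sub>P ` pt ` (aff \<inter> L)" using M by (simp add: bij_betw_def)
    also have "\<dots> = ovoid ` \<alpha> ` (aff \<inter> L)"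
      unfolding image_image by (intro image_cong refl) (simp add: pts)
    finally show ?thesis using rosette_line_map[OF lines_GA_GS[OF L]] by simp
  qed
  ultimately show ?thesis using extends_to_automorphism by blast
qed

text \<open>A vector orthogonal to \<open>H\<close> but not to some \<open>x\<close> outside
  \<open>H\<close> has \<open>H\<close> as its perpendicular space, by dimension. If it were
  singular, \<open>H\<close> would be tangent.\<close>

lemma (in elliptic_space) nontangent_hyperplane_polar:
  assumes H: "hyperplane H" and nt: "\<not> tangent_hyperplane Q H"
  obtains p where "Q p \<noteq> 0" "H = {v. B p v = 0}"
proof -
  have sub: "vec.subspace H" and dimH: "vec.dim H = 5" using H by (simp_all add: hyperplane_def)
  have dimU: "vec.dim (UNIV :: ('a ^ 6) set) = 6" by (subst vec_dim_card) simp
  have "H \<noteq> UNIV" using dimU dimH by auto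
  then obtain x where "x \<notin> vec.span H" using sub by (auto simp: vec.span_eq_iff[THEN iffD2])
  then obtain p where p: "p \<in> perp_space H" "B x p = 1" by (rule separation)
  have "H \<subseteq> {v. B p v = 0}" using p B_sym by (auto simp: perp_space_def)
  moreover have "vec.dim {v. B p v = 0} = 5"
    using dim_kernel(2)[of UNIV x p] p(2) B_sym[of x p] dimU by simp
  ultimately have H_eq: "H = {v. B p v = 0}"
    using vec.subspace_dim_equal[OF sub subspace_perp_vec] dimH by simp
  have "p \<noteq> 0" using p(2) by auto
  hence "Q p \<noteq> 0" using nt H H_eq by (auto simp: tangent_hyperplane_def)
  thus thesis using H_eq by (rule that)
qed

theorem mainTheorem3:
  fixes Q :: "'a::{field, finite} ^ 6 \<Rightarrow> 'a"
    and H :: "('a ^ 6) set"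
    and S S' A :: "(('a ^ 6) set, ('a ^ 6) set) geometry"
    and E :: "(('a ^ 6) set set, ('a ^ 6) set set set) geometry"
    and \<gamma>\<^sub>P :: "('a ^ 6) set \<Rightarrow> ('a ^ 6) set set"
    and \<gamma>\<^sub>L :: "('a ^ 6) set \<Rightarrow> ('a ^ 6) set set set"
  assumes "nonsingular_elliptic Q"
    and "hyperplane H" and "\<not> tangent_hyperplane Q H"
    and "S = quadric_geometry Q"
    and "S' = quadric_section Q H"
    and "A = complement_geometry S S'"
    and "E = ovoid_geometry S S'"
    and "cover A E \<gamma>\<^sub>P \<gamma>\<^sub>L"
  shows "\<exists>\<alpha>\<^sub>P \<alpha>\<^sub>L. automorphism S \<alpha>\<^sub>P \<alpha>\<^sub>L \<and> stabilizes \<alpha>\<^sub>P \<alpha>\<^sub>L S' \<and>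
           (\<forall>x\<in>points A. \<gamma>\<^sub>P x = subtended_ovoid S S' (\<alpha>\<^sub>P x)) \<and>
           (\<forall>L\<in>lines A. \<gamma>\<^sub>L L = rosette S S' (\<alpha>\<^sub>L L))"
proof -
  interpret elliptic_space Q
    by unfold_locales (use assms(1) in \<open>simp_all add: nonsingular_elliptic_def\<close>)
  obtain p where p: "Q p \<noteq> 0" "H = {v. polar_form Q p v = 0}"
    using nontangent_hyperplane_polar[OF assms(2,3)] .
  interpret ovoid_cover Q p \<gamma>\<^sub>P \<gamma>\<^sub>L
    by unfold_locales (use assms(4-8) p in simp_all)
  show ?thesis using cover_factors unfolding assms(4-7) p(2) .
qed

end
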